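(* All flat left invariant metrics on $\mathrm{E}(2)$ are fixed points for the cross curvature flow ($\mathrm{XCF}$) on $\mathrm{E}(2)$ (and are thus trivial steady algebraic solitons). These are the only algebraic solitons for the $\mathrm{XCF}$ on $\mathrm{E}(2)$: if a left invariant Riemannian metric on $\mathrm{E}(2)$ is an algebraic soliton for the $\mathrm{XCF}$, then it is flat.
   Context: $\mathrm{E}(2)$ is the simply connected three-dimensional Lie group (of orientation preserving isometries of the Euclidean plane, up to covering) whose Lie algebra $\mathfrak{h}$ has a basis $\mathbf{e}_1,\mathbf{e}_2,\mathbf{e}_3$ with non-zero brackets $[\mathbf{e}_2,\mathbf{e}_3]=\mathbf{e}_1$, $[\mathbf{e}_3,\mathbf{e}_1]=\mathbf{e}_2$. Cross curvature tensor: for a Riemannian metric $\mathbf{g}$ on a three-manifold with Ricci tensor $R_{ij}$ and scalar curvature $S$, put $P^{ij}=g^{ik}g^{jl}R_{kl}-\frac{S}{2}g^{ij}$. When $(P^{ij})$ is invertible with inverse $(V_{ij})$, the cross curvature tensor $\mathbf{H}[\mathbf{g}]$ has components $H_{ij}=\frac{\det P^{kl}}{\det g^{kl}}V_{ij}$. Equivalently, and also when $P$ is not invertible, in a local orthonormal frame $\mathbf{f}_1,\mathbf{f}_2,\mathbf{f}_3$ diagonalizing the Ricci tensor, $\mathbf{H}$ is diagonal with $H_{ll}=K_mK_n$ for $(l,m,n)$ any permutation of $(1,2,3)$, where $K_l$ is the sectional curvature of the plane spanned by $\mathbf{f}_m,\mathbf{f}_n$. The $\pm\mathrm{XCF}$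 is $\frac{\partial\mathbf{g}}{\partial t}=\pm2\mathbf{H}[\mathbf{g}]$; "XCF" refers to either sign. A metric is a fixed point if $\mathbf{H}[\mathbf{g}]=0$. For algebraic solitons of $\pm\mathrm{XCF}$ one uses $\mathbf{T}=\pm\mathbf{H}$. The operator $\widehat{\mathbf{T}[\mathbf{g}]}:\mathfrak{h}\to\mathfrak{h}$ is defined by $\mathbf{g}(\widehat{\mathbf{T}[\mathbf{g}]}(X),Y)=\mathbf{T}[\mathbf{g}](X,Y)$. A left invariant metric $\mathbf{g}$ is an algebraic $\mathbf{T}$-soliton with soliton constant $\kappa\in\mathbb{R}$ if $\widehat{\mathbf{T}[\mathbf{g}]}-\kappa\,\mathrm{Id}$ is a derivation of $\mathfrak{h}$; it is steady if $\kappa=0$. *)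

theory Defs
  imports "HOL-Analysis.Analysis"
begin

section \<open>Riemannian geometry in a global chart\<close>

text \<open>
  The manifold underlying the simply connected group \<open>E(2)\<close> is \<open>\<real>\<^sup>3\<close>, so tensor fields are given
  by their components in the global coordinates of \<^typ>\<open>real^3\<close>. A covariant 2-tensor field is a
  function \<open>T\<close> with \<open>T p $ i $ j = T\<^sub>i\<^sub>j(p)\<close>.
\<close>

type_synonym tensor_field = "real^3 \<Rightarrow> real^3^3"

definition form :: "real^3^3 \<Rightarrow> real^3 \<Rightarrow> real^3 \<Rightarrow> real" where
  "form A u v = (\<Sum>i\<in>UNIV. \<Sum>j\<in>UNIV. A $ i $ j * u $ i * v $ j)"

definition partial_deriv :: "3 \<Rightarrow> (real^3 \<Rightarrow> real) \<Rightarrow> real^3 \<Rightarrow> real" where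
  "partial_deriv i f p = frechet_derivative f (at p) (axis i 1)"

primrec C_class :: "nat \<Rightarrow> (real^3 \<Rightarrow> real) \<Rightarrow> bool" where
  "C_class 0 f \<longleftrightarrow> continuous_on UNIV f"
| "C_class (Suc k) f \<longleftrightarrow> (\<forall>p. f differentiable at p) \<and> (\<forall>i. C_class k (partial_deriv i f))"

definition smooth :: "(real^3 \<Rightarrow> real) \<Rightarrow> bool" where
  "smooth f \<longleftrightarrow> (\<forall>k. C_class k f)"

definition riemannian_metric :: "tensor_field \<Rightarrow> bool" where
  "riemannian_metric g \<longleftrightarrow>
     (\<forall>i j. smooth (\<lambda>p. g p $ i $ j)) \<and>
     (\<forall>p u v. form (g p) u v = form (g p) v u) \<and>
     (\<forall>p u. u \<noteq> 0 \<longrightarrow> form (g p) u u > 0)"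

text \<open>\<open>christoffel g p k i j\<close> is \<open>\<Gamma>\<^sup>k\<^sub>i\<^sub>j(p)\<close>.\<close>

definition christoffel :: "tensor_field \<Rightarrow> real^3 \<Rightarrow> 3 \<Rightarrow> 3 \<Rightarrow> 3 \<Rightarrow> real" where
  "christoffel g p k i j =
     (1/2) * (\<Sum>l\<in>UNIV. matrix_inv (g p) $ k $ l *
       (partial_deriv i (\<lambda>q. g q $ j $ l) p + partial_deriv j (\<lambda>q. g q $ i $ l) p
        - partial_deriv l (\<lambda>q. g q $ i $ j) p))"

text \<open>
  \<open>riemann g p l i j k\<close> is the \<open>\<partial>\<^sub>l\<close>-component of
  \<open>R(\<partial>\<^sub>i, \<partial>\<^sub>j) \<partial>\<^sub>k = \<nabla>\<^sub>i \<nabla>\<^sub>j \<partial>\<^sub>k - \<nabla>\<^sub>j \<nabla>\<^sub>i \<partial>\<^sub>k\<close>. With this sign the Ricci tensor is the trace over \<open>l = i\<close>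
  and the unit sphere has sectional curvature \<open>1\<close>.
\<close>

definition riemann :: "tensor_field \<Rightarrow> real^3 \<Rightarrow> 3 \<Rightarrow> 3 \<Rightarrow> 3 \<Rightarrow> 3 \<Rightarrow> real" where
  "riemann g p l i j k =
     partial_deriv i (\<lambda>q. christoffel g q l j k) p - partial_deriv j (\<lambda>q. christoffel g q l i k) p
     + (\<Sum>m\<in>UNIV. christoffel g p l i m * christoffel g p m j k
                 - christoffel g p l j m * christoffel g p m i k)"

definition curvature :: "tensor_field \<Rightarrow> real^3 \<Rightarrow> real^3 \<Rightarrow> real^3 \<Rightarrow> real^3 \<Rightarrow> real^3" where
  "curvature g p u v w =
     (\<chi> l. \<Sum>i\<in>UNIV. \<Sum>j\<in>UNIV. \<Sum>k\<in>UNIV. riemann g p l i j k * u $ i * v $ j * w $ k)"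

definition flat_metric :: "tensor_field \<Rightarrow> bool" where
  "flat_metric g \<longleftrightarrow> (\<forall>p u v w. curvature g p u v w = 0)"

definition ricci :: "tensor_field \<Rightarrow> tensor_field" where
  "ricci g p = (\<chi> j k. \<Sum>i\<in>UNIV. riemann g p i i j k)"

definition scalar_curvature :: "tensor_field \<Rightarrow> real^3 \<Rightarrow> real" where
  "scalar_curvature g p =
     (\<Sum>i\<in>UNIV. \<Sum>j\<in>UNIV. matrix_inv (g p) $ i $ j * ricci g p $ i $ j)"

definition sectional_curvature :: "tensor_field \<Rightarrow> real^3 \<Rightarrow> real^3 \<Rightarrow> real^3 \<Rightarrow> real" where
  "sectional_curvature g p u v =
     form (g p) (curvature g p u v v) u /
     (form (g p) u u * form (g p) v v - (form (g p) u v)\<^sup>2)"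


section \<open>The cross curvature tensor\<close>

text \<open>\<open>P_tensor g p $ i $ j\<close> has upper indices: it is \<open>P\<^sup>i\<^sup>j(p)\<close>.\<close>

definition P_tensor :: "tensor_field \<Rightarrow> real^3 \<Rightarrow> real^3^3" where
  "P_tensor g p =
     (\<chi> i j. (\<Sum>k\<in>UNIV. \<Sum>l\<in>UNIV.
                matrix_inv (g p) $ i $ k * matrix_inv (g p) $ j $ l * ricci g p $ k $ l)
             - scalar_curvature g p / 2 * matrix_inv (g p) $ i $ j)"

definition ricci_frame :: "tensor_field \<Rightarrow> real^3 \<Rightarrow> (3 \<Rightarrow> real^3) \<Rightarrow> bool" where
  "ricci_frame g p f \<longleftrightarrow>
     (\<forall>a b. form (g p) (f a) (f b) = (if a = b then 1 else 0)) \<and>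
     (\<forall>a b. a \<noteq> b \<longrightarrow> form (ricci g p) (f a) (f b) = 0)"

text \<open>
  \<open>A\<close> is diagonal in the frame \<open>f\<close>, with \<open>A\<^sub>l\<^sub>l = K\<^sub>m K\<^sub>n\<close>, where \<open>K\<^sub>m\<close> and \<open>K\<^sub>n\<close> are the sectional
  curvatures of the planes orthogonal to \<open>f\<^sub>m\<close> and \<open>f\<^sub>n\<close>.
\<close>

definition cross_diagonal :: "tensor_field \<Rightarrow> real^3 \<Rightarrow> (3 \<Rightarrow> real^3) \<Rightarrow> real^3^3 \<Rightarrow> bool" where
  "cross_diagonal g p f A \<longleftrightarrow>
     (\<forall>a b. a \<noteq> b \<longrightarrow> form A (f a) (f b) = 0) \<and>
     (\<forall>l m n. distinct [l, m, n] \<longrightarrow>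
        form A (f l) (f l) =
          sectional_curvature g p (f n) (f l) * sectional_curvature g p (f l) (f m))"

text \<open>
  Where \<open>P\<close> is not invertible the tensor is given by the description in frames that diagonalize the
  Ricci tensor. Such frames exist by the spectral theorem, and all of them determine the same tensor
  (the cofactor matrix of \<open>P\<close> divided by \<open>det (g\<^sup>k\<^sup>l)\<close>), so the description is unambiguous.
\<close>

definition cross_curvature :: "tensor_field \<Rightarrow> tensor_field" where
  "cross_curvature g p =
     (if invertible (P_tensor g p)
      then (det (P_tensor g p) / det (matrix_inv (g p))) *\<^sub>R matrix_inv (P_tensor g p)
      else (THE A. \<forall>f. ricci_frame g p f \<longrightarrow> cross_diagonal g p f A))"

definition xcf_fixed_point :: "tensor_field \<Rightarrow> bool" where
  "xcf_fixed_point g \<longleftrightarrow> (\<forall>p. cross_curvature g p = 0)"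


section \<open>The group \<open>E(2)\<close> and its Lie algebra\<close>

text \<open>
  The universal cover of the group of orientation preserving isometries of the plane: \<open>(x, y, \<theta>)\<close>
  covers the rotation by \<open>\<theta>\<close> followed by the translation by \<open>(x, y)\<close>. The identity element is \<open>0\<close>,
  and the Lie algebra is the tangent space \<^typ>\<open>real^3\<close> at \<open>0\<close>.
\<close>

definition E2_mult :: "real^3 \<Rightarrow> real^3 \<Rightarrow> real^3" where
  "E2_mult p q = vector [p $ 1 + cos (p $ 3) * q $ 1 - sin (p $ 3) * q $ 2,
                         p $ 2 + sin (p $ 3) * q $ 1 + cos (p $ 3) * q $ 2,
                         p $ 3 + q $ 3]"

definition E2_left_diff :: "real^3 \<Rightarrow> real^3 \<Rightarrow> real^3 \<Rightarrow> real^3" where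
  "E2_left_diff a p = frechet_derivative (E2_mult a) (at p)"

definition field_bracket :: "(real^3 \<Rightarrow> real^3) \<Rightarrow> (real^3 \<Rightarrow> real^3) \<Rightarrow> real^3 \<Rightarrow> real^3" where
  "field_bracket X Y p = frechet_derivative Y (at p) (X p) - frechet_derivative X (at p) (Y p)"

text \<open>The bracket of two tangent vectors at \<open>0\<close> is that of their left invariant extensions.\<close>

definition E2_bracket :: "real^3 \<Rightarrow> real^3 \<Rightarrow> real^3" where
  "E2_bracket u v = field_bracket (\<lambda>p. E2_left_diff p 0 u) (\<lambda>p. E2_left_diff p 0 v) 0"

definition left_invariant :: "tensor_field \<Rightarrow> bool" where
  "left_invariant T \<longleftrightarrow>
     (\<forall>a p u v. form (T (E2_mult a p)) (E2_left_diff a p u) (E2_left_diff a p v) = form (T p) u v)"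

definition E2_derivation :: "(real^3 \<Rightarrow> real^3) \<Rightarrow> bool" where
  "E2_derivation D \<longleftrightarrow>
     linear D \<and> (\<forall>u v. D (E2_bracket u v) = E2_bracket (D u) v + E2_bracket u (D v))"


section \<open>Algebraic solitons\<close>

definition hat_operator :: "(tensor_field \<Rightarrow> tensor_field) \<Rightarrow> tensor_field \<Rightarrow> real^3 \<Rightarrow> real^3" where
  "hat_operator T g u = (THE w. \<forall>v. form (g 0) w v = form (T g 0) u v)"

definition algebraic_soliton ::
    "(tensor_field \<Rightarrow> tensor_field) \<Rightarrow> tensor_field \<Rightarrow> real \<Rightarrow> bool" where
  "algebraic_soliton T g \<kappa> \<longleftrightarrow>
     riemannian_metric g \<and> left_invariant g \<and> E2_derivation (\<lambda>u. hat_operator T g u - \<kappa> *\<^sub>R u)"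

definition steady_algebraic_soliton :: "(tensor_field \<Rightarrow> tensor_field) \<Rightarrow> tensor_field \<Rightarrow> bool" where
  "steady_algebraic_soliton T g \<longleftrightarrow> algebraic_soliton T g 0"

text \<open>The tensor \<open>T = \<plusminus>H\<close> of the flow \<open>\<plusminus>XCF\<close>; the sign is \<open>\<epsilon> \<in> {1, -1}\<close>.\<close>

definition xcf_tensor :: "real \<Rightarrow> tensor_field \<Rightarrow> tensor_field" where
  "xcf_tensor \<epsilon> g p = \<epsilon> *\<^sub>R cross_curvature g p"


section \<open>Group laws and brackets of the model\<close>

lemma E2_mult_assoc: "E2_mult (E2_mult a b) c = E2_mult a (E2_mult b c)"
  by (simp add: E2_mult_def vec_eq_iff forall_3 cos_add sin_add algebra_simps)

lemma E2_mult_zero: "E2_mult 0 p = p" "E2_mult p 0 = p"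
  by (simp_all add: E2_mult_def vec_eq_iff forall_3)

lemma E2_left_inverse: "\<exists>b. E2_mult b a = 0"
proof
  let ?c = "cos (a $ 3)" and ?s = "sin (a $ 3)"
  show "E2_mult (vector [- ?c * a $ 1 - ?s * a $ 2, ?s * a $ 1 - ?c * a $ 2, - a $ 3]) a = 0"
    by (simp add: E2_mult_def vec_eq_iff forall_3)
qed

lemma E2_left_diff_eq:
  "E2_left_diff a p u = vector [cos (a $ 3) * u $ 1 - sin (a $ 3) * u $ 2,
                                sin (a $ 3) * u $ 1 + cos (a $ 3) * u $ 2, u $ 3]"
proof -
  let ?D = "\<lambda>u::real^3. vector [cos (a $ 3) * u $ 1 - sin (a $ 3) * u $ 2,
                                sin (a $ 3) * u $ 1 + cos (a $ 3) * u $ 2, u $ 3] :: real^3"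
  have "linear ?D"
    by (rule linearI) (simp_all add: vec_eq_iff forall_3 algebra_simps)
  then have D: "(?D has_derivative ?D) (at p)"
    by (simp add: linear_conv_bounded_linear bounded_linear_imp_has_derivative)
  have "E2_mult a = (\<lambda>q. a + ?D q)"
    by (simp add: fun_eq_iff E2_mult_def vec_eq_iff forall_3)
  moreover have "((\<lambda>q. a + ?D q) has_derivative ?D) (at p)"
    using has_derivative_add[OF has_derivative_const[of a] D] by (simp only: add_0_left)
  ultimately have "(E2_mult a has_derivative ?D) (at p)"
    by (simp only:)
  then have "?D = E2_left_diff a p"
    unfolding E2_left_diff_def by (rule frechet_derivative_at)
  then show ?thesis
    by (rule fun_cong[symmetric])
qed

lemma E2_bracket_eq:
  "E2_bracket u v = vector [u $ 2 * v $ 3 - u $ 3 * v $ 2, u $ 3 * v $ 1 - u $ 1 * v $ 3, 0]"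
proof -
  have D: "frechet_derivative (\<lambda>p. E2_left_diff p 0 u) (at 0) =
           (\<lambda>h. vector [- h $ 3 * u $ 2, h $ 3 * u $ 1, 0])" for u
  proof -
    let ?a = "vector [u $ 1, u $ 2, 0] :: real^3" and ?b = "vector [- u $ 2, u $ 1, 0] :: real^3"
    have "((\<lambda>p::real^3. cos (p $ 3) *\<^sub>R ?a + sin (p $ 3) *\<^sub>R ?b + vector [0, 0, u $ 3])
            has_derivative (\<lambda>h. h $ 3 *\<^sub>R ?b)) (at 0)"
      by (auto intro!: derivative_eq_intros bounded_linear_imp_has_derivative bounded_linear_vec_nth)
    moreover have "(\<lambda>p. E2_left_diff p 0 u) =
        (\<lambda>p::real^3. cos (p $ 3) *\<^sub>R ?a + sin (p $ 3) *\<^sub>R ?b + vector [0, 0, u $ 3])"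
      by (simp add: fun_eq_iff E2_left_diff_eq vec_eq_iff forall_3)
    moreover have "(\<lambda>h::real^3. h $ 3 *\<^sub>R ?b) = (\<lambda>h. vector [- h $ 3 * u $ 2, h $ 3 * u $ 1, 0])"
      by (simp add: fun_eq_iff vec_eq_iff forall_3)
    ultimately have "((\<lambda>p. E2_left_diff p 0 u) has_derivative
            (\<lambda>h. vector [- h $ 3 * u $ 2, h $ 3 * u $ 1, 0])) (at 0)"
      by (simp only:)
    then show ?thesis
      by (rule frechet_derivative_at[symmetric])
  qed
  show ?thesis
    unfolding E2_bracket_def field_bracket_def D
    by (simp add: E2_left_diff_eq vec_eq_iff forall_3)
qed

lemma E2_brackets:
  "E2_bracket (axis 2 1) (axis 3 1) = axis 1 1"
  "E2_bracket (axis 3 1) (axis 1 1) = axis 2 1"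
  "E2_bracket (axis 1 1) (axis 2 1) = 0"
  by (simp_all add: E2_bracket_eq vec_eq_iff forall_3 axis_def)

end

theory Submission
  imports Defs
begin

text \<open>
  A left invariant metric on \<open>E(2)\<close> has at each point an orthonormal frame with
  \<open>[f\<^sub>2, f\<^sub>3] = a f\<^sub>1\<close>, \<open>[f\<^sub>3, f\<^sub>1] = b f\<^sub>2\<close>, \<open>[f\<^sub>1, f\<^sub>2] = 0\<close> and \<open>a b > 0\<close>. It diagonalizes the Ricci tensor,
  hence the cross curvature \<open>H\<close>. If \<open>\<plusminus>H - \<kappa>\<close> is a derivation with eigenvalues \<open>d\<^sub>i\<close>, the two nonzero
  brackets give \<open>d\<^sub>1 = d\<^sub>2 + d\<^sub>3\<close> and \<open>d\<^sub>2 = d\<^sub>3 + d\<^sub>1\<close>, so \<open>H\<^sub>1\<^sub>1 = H\<^sub>2\<^sub>2\<close>. By Milnor's curvature formulas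
  \<open>H\<^sub>1\<^sub>1 - H\<^sub>2\<^sub>2 = (a - b)\<^sup>3 (a + b) / 4\<close>, so \<open>a = b\<close>, and then the curvature vanishes.
\<close>

section \<open>Orthonormal frames\<close>

lemma form_inner: "form A u v = u \<bullet> (A *v v)"
  by (simp add: form_def inner_vec_def matrix_vector_mult_def sum_distrib_left mult_ac)

lemma form_axis: "form A (axis i 1) (axis j 1) = A $ i $ j"
  by (simp add: form_inner matrix_vector_mult_basis inner_axis' column_def)

lemma bilinear_form: "bilinear (form A)"
  unfolding bilinear_def
  by (auto intro!: linearI simp: form_inner inner_simps matrix_vector_right_distrib
      matrix_vector_mult_scaleR)

lemmas form_simps =
  bilinear_ladd[OF bilinear_form] bilinear_radd[OF bilinear_form]
  bilinear_lsub[OF bilinear_form] bilinear_rsub[OF bilinear_form]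
  bilinear_lneg[OF bilinear_form] bilinear_rneg[OF bilinear_form]
  bilinear_lmul[OF bilinear_form] bilinear_rmul[OF bilinear_form]
  bilinear_lzero[OF bilinear_form] bilinear_rzero[OF bilinear_form]

definition frame_matrix :: "(3 \<Rightarrow> real^3) \<Rightarrow> real^3^3" where
  "frame_matrix f = (\<chi> i a. f a $ i)"

definition orthonormal_frame :: "real^3^3 \<Rightarrow> (3 \<Rightarrow> real^3) \<Rightarrow> bool" where
  "orthonormal_frame G f \<longleftrightarrow> (\<forall>a b. form G (f a) (f b) = (if a = b then 1 else 0))"

text \<open>Congruence by the frame matrix passes to frame components, so that diagonality in a
  frame becomes an identity between matrices.\<close>

lemma form_frame_matrix:
  "(transpose (frame_matrix f) ** A ** frame_matrix f) $ a $ b = form A (f a) (f b)"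
  unfolding form_def
  by (subst sum.swap) (simp add: frame_matrix_def matrix_matrix_mult_def transpose_def
      sum_distrib_right sum_distrib_left mult_ac)

lemma matrix_inv_eqI:
  fixes A B :: "real^'n^'n"
  assumes "A ** B = mat 1"
  shows "matrix_inv A = B"
proof -
  have BA: "B ** A = mat 1" using assms matrix_left_right_inverse by blast
  \<comment> \<open>\<open>matrix_inv\<close> is defined by choice; \<open>B\<close> witnesses that
    a two-sided inverse exists, so the chosen matrix is one.\<close>
  have "A ** matrix_inv A = mat 1"
    unfolding matrix_inv_def by (rule someI2[of _ B]) (use assms BA in auto)
  then have "B ** A ** matrix_inv A = B" by (simp flip: matrix_mul_assoc)
  then show ?thesis by (simp add: BA)
qed

lemma matrix_mul_inv:
  fixes A :: "real^'n^'n"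
  assumes "invertible A"
  shows "A ** matrix_inv A = mat 1"
  using assms matrix_inv_eqI unfolding invertible_def by metis

context
  fixes G :: "real^3^3" and f :: "3 \<Rightarrow> real^3"
  assumes ortho: "orthonormal_frame G f"
begin

private abbreviation "F \<equiv> frame_matrix f"

lemma frame_gram: "transpose F ** G ** F = mat 1"
  using ortho by (simp add: vec_eq_iff form_frame_matrix orthonormal_frame_def mat_def)

lemma frame_matrix_right: "F ** (transpose F ** G) = mat 1"
  using frame_gram matrix_left_right_inverse by blast

lemma frame_matrix_left: "G ** F ** transpose F = mat 1"
proof -
  have "(F ** transpose F) ** G = mat 1"
    using frame_matrix_right by (simp add: matrix_mul_assoc)
  then show ?thesis
    using matrix_left_right_inverse by (metis matrix_mul_assoc)
qed

lemma frame_metric_inv: "matrix_inv G = F ** transpose F"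
  by (rule matrix_inv_eqI) (simp add: matrix_mul_assoc frame_matrix_left)

lemma det_frame_matrix: "det F \<noteq> 0"
  using arg_cong[OF frame_matrix_right, of det] by (auto simp: det_mul)

lemma frame_expand: "v = (\<Sum>a\<in>UNIV. form G (f a) v *\<^sub>R f a)"
proof -
  have "v = F *v ((transpose F ** G) *v v)"
    by (simp add: matrix_vector_mul_assoc frame_matrix_right)
  also have "(transpose F ** G) *v v = (\<chi> a. form G (f a) v)"
    by (simp add: vec_eq_iff form_inner matrix_vector_mul_assoc[symmetric] frame_matrix_def
        transpose_def matrix_vector_mult_def[of "\<chi> i. f i"] inner_vec_def)
  also have "F *v (\<chi> a. form G (f a) v) = (\<Sum>a\<in>UNIV. form G (f a) v *\<^sub>R f a)"
    by (simp add: vec_eq_iff matrix_vector_mult_def frame_matrix_def mult_ac)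
  finally show ?thesis .
qed

text \<open>Multiplying by \<open>G ** F\<close> on the left and by \<open>transpose F ** G\<close>
  on the right undoes the congruence.\<close>

lemma frame_matrix_cancel:
  assumes "transpose F ** A ** F = transpose F ** B ** F"
  shows "A = B"
proof -
  have "X = (G ** F) ** (transpose F ** X ** F) ** (transpose F ** G)" for X
  proof -
    have "X = ((G ** F) ** transpose F) ** X ** (F ** (transpose F ** G))"
      by (simp only: frame_matrix_left frame_matrix_right matrix_mul_lid matrix_mul_rid)
    then show ?thesis by (simp only: matrix_mul_assoc)
  qed
  from this[of A, unfolded assms] this[of B, symmetric] show ?thesis by (rule trans)
qed

lemma form_frame_eqI:
  assumes "\<And>a b. form A (f a) (f b) = form B (f a) (f b)"
  shows "A = B"
  by (rule frame_matrix_cancel) (simp add: vec_eq_iff form_frame_matrix assms)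

lemma frame_linear_eqI:
  assumes "linear S" "linear T" "\<And>a. S (f a) = T (f a)"
  shows "S v = T v"
  by (subst (1 2) frame_expand[of v])
     (simp add: linear_sum[OF assms(1)] linear_sum[OF assms(2)]
       linear_scale[OF assms(1)] linear_scale[OF assms(2)] assms(3))

text \<open>Since \<open>transpose F ** G\<close> inverts \<open>F\<close>, the sum is the trace of
  a matrix similar to \<open>M\<close>.\<close>

lemma frame_trace:
  fixes M :: "real^3^3"
  shows "trace M = (\<Sum>a\<in>UNIV. form G (f a) (M *v f a))"
proof -
  have "trace M = trace ((M ** F) ** (transpose F ** G))"
    by (simp add: matrix_mul_assoc[symmetric] frame_matrix_right)
  also have "\<dots> = trace (transpose F ** (G ** M) ** F)"
    by (subst trace_mul_sym) (simp add: matrix_mul_assoc)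
  also have "\<dots> = (\<Sum>a\<in>UNIV. form (G ** M) (f a) (f a))"
    by (simp add: trace_def form_frame_matrix)
  finally show ?thesis
    by (simp add: form_inner matrix_vector_mul_assoc)
qed

end

section \<open>Left invariant metrics\<close>

text \<open>The differential of left translation by \<open>p\<close>. In this chart left
  translations are affine, so it is the same at every base point.\<close>

definition E2_rot :: "real^3 \<Rightarrow> real^3^3" where
  "E2_rot p = vector [vector [cos (p $ 3), - sin (p $ 3), 0], vector [sin (p $ 3), cos (p $ 3), 0],
     vector [0, 0, 1]]"

text \<open>The derivative of \<open>E2_rot\<close> with respect to the angle, at angle
  zero.\<close>

definition rot_gen :: "real^3^3" where
  "rot_gen = vector [vector [0, -1, 0], vector [1, 0, 0], vector [0, 0, 0]]"

lemma rot_gen_nth: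
  "rot_gen $ 1 $ 1 = 0" "rot_gen $ 1 $ 2 = -1" "rot_gen $ 1 $ 3 = 0"
  "rot_gen $ 2 $ 1 = 1" "rot_gen $ 2 $ 2 = 0" "rot_gen $ 2 $ 3 = 0"
  "rot_gen $ 3 $ 1 = 0" "rot_gen $ 3 $ 2 = 0" "rot_gen $ 3 $ 3 = 0"
  by (simp_all add: rot_gen_def)

text \<open>
  Along the \<open>\<theta>\<close>-axis a left invariant metric evolves by conjugation with rotations, so its
  \<open>\<theta>\<close>-derivative at \<open>p\<close> is algebraic in its value at \<open>p\<close>.
\<close>

definition rot_action :: "real^3^3 \<Rightarrow> real^3^3" where
  "rot_action X = rot_gen ** X + X ** transpose rot_gen"

lemma E2_left_diff_rot: "E2_left_diff a p u = E2_rot a *v u"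
  by (simp add: E2_left_diff_eq E2_rot_def vec_eq_iff forall_3 matrix_vector_mult_def sum_3)

lemma E2_rot_orthogonal: "transpose (E2_rot p) ** E2_rot p = mat 1"
    "E2_rot p ** transpose (E2_rot p) = mat 1"
proof -
  have "cos (p $ 3) * cos (p $ 3) + sin (p $ 3) * sin (p $ 3) = 1"
     "sin (p $ 3) * sin (p $ 3) + cos (p $ 3) * cos (p $ 3) = 1"
    using sin_cos_squared_add3 [of "p$3"] by (auto simp: algebra_simps)
  then show "transpose (E2_rot p) ** E2_rot p = mat 1" 
    by (simp add: E2_rot_def vec_eq_iff forall_3 matrix_matrix_mult_def sum_3 transpose_def mat_def)
  then show "E2_rot p ** transpose (E2_rot p) = mat 1"
    using matrix_left_right_inverse by blast
qed

text \<open>Translation by \<open>p\<close> carries the identity to \<open>p\<close> with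
  differential \<open>E2_rot p\<close>, so invariance gives \<open>g 0\<close> as a congruence of
  \<open>g p\<close>; orthogonality of the rotation solves for \<open>g p\<close>.\<close>

lemma left_invariant_rot:
  assumes "left_invariant g"
  shows "g p = E2_rot p ** g 0 ** transpose (E2_rot p)"
proof -
  let ?R = "E2_rot p"
  have "form (g p) (?R *v u) (?R *v v) = form (g 0) u v" for u v
    using assms[unfolded left_invariant_def, rule_format, of p 0 u v]
    by (simp add: E2_mult_zero E2_left_diff_rot)
  moreover have "form (transpose ?R ** g p ** ?R) u v = form (g p) (?R *v u) (?R *v v)" for u v
  proof -
    have "u \<bullet> (transpose ?R *v w) = (?R *v u) \<bullet> w" for w
      by (simp add: inner_commute[of u] dot_lmul_matrix inner_commute[of w])
    then show ?thesis
      by (simp add: form_inner flip: matrix_vector_mul_assoc)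
  qed
  ultimately have "(transpose ?R ** g p ** ?R) $ i $ j = g 0 $ i $ j" for i j
    by (simp flip: form_axis)
  then have "transpose ?R ** g p ** ?R = g 0" by (simp add: vec_eq_iff)
  then have "?R ** g 0 ** transpose ?R = ?R ** (transpose ?R ** g p ** ?R) ** transpose ?R"
    by simp
  also have "\<dots> = (?R ** transpose ?R) ** g p ** (?R ** transpose ?R)"
    by (simp only: matrix_mul_assoc)
  finally show ?thesis by (simp add: E2_rot_orthogonal)
qed

lemma riemannian_invertible:
  assumes "riemannian_metric g"
  shows "invertible (g p)"
proof -
  have "v = 0" if "g p *v v = 0" for v
    using assms that unfolding riemannian_metric_def form_inner by (metis inner_zero_right order_less_irrefl)
  then show ?thesis
    using invertible_left_inverse matrix_left_invertible_ker by blast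
qed

text \<open>The transpose of a rotation is its inverse, so the inverse metric rotates exactly as the
  metric does. Hence \<open>rot_action\<close> gives the \<theta>-derivatives of both.\<close>

lemma left_invariant_inv_rot:
  assumes "riemannian_metric g" "left_invariant g"
  shows "matrix_inv (g p) = E2_rot p ** matrix_inv (g 0) ** transpose (E2_rot p)"
proof (rule matrix_inv_eqI)
  let ?R = "E2_rot p"
  have "g p ** (?R ** matrix_inv (g 0) ** transpose ?R) =
        ?R ** g 0 ** (transpose ?R ** ?R) ** matrix_inv (g 0) ** transpose ?R"
    by (subst left_invariant_rot[OF assms(2)]) (simp only: matrix_mul_assoc)
  also have "\<dots> = ?R ** (g 0 ** matrix_inv (g 0)) ** transpose ?R"
    by (simp add: E2_rot_orthogonal matrix_mul_assoc)
  finally show "g p ** (?R ** matrix_inv (g 0) ** transpose ?R) = mat 1"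
    by (simp add: matrix_mul_inv riemannian_invertible[OF assms(1)] E2_rot_orthogonal)
qed

section \<open>Derivatives of left invariant tensors along the angle\<close>

lemma has_derivative_E2_rot:
  "((\<lambda>q. E2_rot q $ i $ j) has_derivative (\<lambda>h. h $ 3 * (rot_gen ** E2_rot p) $ i $ j)) (at p)"
proof -
  have [derivative_intros]: "((\<lambda>q::real^3. q $ 3) has_derivative (\<lambda>h. h $ 3)) (at p)"
    by (rule bounded_linear_imp_has_derivative[OF bounded_linear_vec_nth])
  have "\<forall>i j. ((\<lambda>q. E2_rot q $ i $ j) has_derivative
      (\<lambda>h. h $ 3 * (rot_gen ** E2_rot p) $ i $ j)) (at p)"
    unfolding forall_3
    by (simp add: E2_rot_def rot_gen_def matrix_matrix_mult_def sum_3)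
       (intro conjI; auto intro!: derivative_eq_intros)
  then show ?thesis by blast
qed

lemma has_derivative_E2_rot_conj:
  "((\<lambda>q. (E2_rot q ** M ** transpose (E2_rot q)) $ j $ k) has_derivative
    (\<lambda>h. h $ 3 * rot_action (E2_rot p ** M ** transpose (E2_rot p)) $ j $ k)) (at p)"
proof -
  have conj: "(A ** M ** transpose B) $ j $ k = (\<Sum>l\<in>UNIV. \<Sum>i\<in>UNIV. A $ j $ i * M $ i $ l * B $ k $ l)"
    for A B :: "real^3^3"
    by (simp add: matrix_matrix_mult_def transpose_def sum_distrib_right)
  have "rot_action (E2_rot p ** M ** transpose (E2_rot p)) =
      (rot_gen ** E2_rot p) ** M ** transpose (E2_rot p) + E2_rot p ** M ** transpose (rot_gen ** E2_rot p)"
    by (simp add: rot_action_def matrix_transpose_mul matrix_mul_assoc)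
  then have eq: "rot_action (E2_rot p ** M ** transpose (E2_rot p)) $ j $ k =
     (\<Sum>l\<in>UNIV. \<Sum>i\<in>UNIV. (rot_gen ** E2_rot p) $ j $ i * M $ i $ l * E2_rot p $ k $ l
        + E2_rot p $ j $ i * M $ i $ l * (rot_gen ** E2_rot p) $ k $ l)"
    by (simp add: conj sum.distrib)
  show ?thesis
    unfolding conj eq
    by (auto intro!: derivative_eq_intros has_derivative_E2_rot
        simp: fun_eq_iff sum_distrib_left algebra_simps)
qed

lemma partial_derivI:
  assumes "(f has_derivative f') (at p)"
  shows "partial_deriv i f p = f' (axis i 1)"
  unfolding partial_deriv_def by (simp flip: frechet_derivative_at[OF assms])

text \<open>\<open>rot_action\<close> is linear with constant coefficients and so commutes with
  differentiation. This supplies the second derivatives of the metric that enter the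
  curvature.\<close>

lemma has_derivative_rot_action:
  assumes "\<And>j k. ((\<lambda>q. X q $ j $ k) has_derivative (\<lambda>h. h $ 3 * rot_action (X p) $ j $ k)) (at p)"
  shows "((\<lambda>q. rot_action (X q) $ j $ k) has_derivative
      (\<lambda>h. h $ 3 * rot_action (rot_action (X p)) $ j $ k)) (at p)"
proof -
  have eq: "rot_action Y $ j $ k = (\<Sum>m\<in>UNIV. rot_gen $ j $ m * Y $ m $ k + rot_gen $ k $ m * Y $ j $ m)" for Y
    by (simp add: rot_action_def matrix_matrix_mult_def transpose_def sum.distrib mult_ac)
  show ?thesis
    unfolding eq[of "X _"] eq[of "rot_action (X p)"]
    by (auto intro!: derivative_eq_intros assms simp: fun_eq_iff sum_distrib_left algebra_simps)
qed

lemma riemannian_symmetric: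
  assumes "riemannian_metric g"
  shows "g p $ i $ j = g p $ j $ i"
  using assms unfolding riemannian_metric_def by (metis form_axis)

lemma has_derivative_metric:
  assumes "left_invariant g"
  shows "((\<lambda>q. g q $ j $ k) has_derivative (\<lambda>h. h $ 3 * rot_action (g p) $ j $ k)) (at p)"
  using has_derivative_E2_rot_conj[of "g 0" j k p]
  by (simp flip: left_invariant_rot[OF assms])

lemma christoffel_left_invariant:
  fixes e :: "3 \<Rightarrow> real"
  assumes "left_invariant g"
  defines "e \<equiv> \<lambda>j. if j = 3 then 1 else 0"
  shows "christoffel g p k i j = (1/2) * (\<Sum>l\<in>UNIV. matrix_inv (g p) $ k $ l *
      (e i * rot_action (g p) $ j $ l + e j * rot_action (g p) $ i $ l - e l * rot_action (g p) $ i $ j))"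
proof -
  have "partial_deriv i (\<lambda>q. g q $ j $ k) p = e i * rot_action (g p) $ j $ k" for i j k
    by (simp add: partial_derivI[OF has_derivative_metric[OF assms(1)]] axis_def e_def)
  then show ?thesis by (simp add: christoffel_def)
qed

text \<open>Left translations are affine in the chart, so the Christoffel symbols rotate like a
  tensor, and their \<theta>-derivative is \<open>rot_gen\<close> acting on each index in turn.
  Upper and lower indices look alike because rotations are orthogonal.\<close>

lemma partial_deriv_christoffel:
  assumes "riemannian_metric g" "left_invariant g"
  shows "partial_deriv i (\<lambda>q. christoffel g q l j k) p =
    (if i = 3 then \<Sum>m\<in>UNIV. rot_gen $ l $ m * christoffel g p m j k + rot_gen $ j $ m * christoffel g p l m k + rot_gen $ k $ m * christoffel g p l j m
     else 0)"
proof -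
  define I where "I q = matrix_inv (g q)" for q
  define e :: "3 \<Rightarrow> real" where "e j = (if j = 3 then 1 else 0)" for j
  note dg = has_derivative_metric[OF assms(2)]
  have dI: "((\<lambda>q. I q $ j $ k) has_derivative (\<lambda>h. h $ 3 * rot_action (I p) $ j $ k)) (at p)" for j k
    unfolding I_def using has_derivative_E2_rot_conj[of "matrix_inv (g 0)" j k p]
    by (simp flip: left_invariant_inv_rot[OF assms(1,2)])
  have ddg: "((\<lambda>q. rot_action (g q) $ j $ k) has_derivative
      (\<lambda>h. h $ 3 * rot_action (rot_action (g p)) $ j $ k)) (at p)" for j k
    by (rule has_derivative_rot_action) (rule dg)
  have chr: "christoffel g q l j k = (1/2) * (\<Sum>m\<in>UNIV. I q $ l $ m *
      (e j * rot_action (g q) $ k $ m + e k * rot_action (g q) $ j $ m - e m * rot_action (g q) $ j $ k))" for q l j k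
    by (simp add: christoffel_left_invariant[OF assms(2)] I_def e_def)
  have d: "((\<lambda>q. \<Sum>m\<in>UNIV. I q $ l $ m *
      (e j * rot_action (g q) $ k $ m + e k * rot_action (g q) $ j $ m - e m * rot_action (g q) $ j $ k))
     has_derivative (\<lambda>h. h $ 3 * (\<Sum>m\<in>UNIV. rot_action (I p) $ l $ m *
      (e j * rot_action (g p) $ k $ m + e k * rot_action (g p) $ j $ m - e m * rot_action (g p) $ j $ k)
      + I p $ l $ m *
      (e j * rot_action (rot_action (g p)) $ k $ m + e k * rot_action (rot_action (g p)) $ j $ m
       - e m * rot_action (rot_action (g p)) $ j $ k)))) (at p)"
    by (auto intro!: derivative_eq_intros dI ddg simp: fun_eq_iff sum_distrib_left algebra_simps)
  have "partial_deriv i (\<lambda>q. christoffel g q l j k) p = e i * ((1/2) * (\<Sum>m\<in>UNIV. rot_action (I p) $ l $ m *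
      (e j * rot_action (g p) $ k $ m + e k * rot_action (g p) $ j $ m - e m * rot_action (g p) $ j $ k)
      + I p $ l $ m *
      (e j * rot_action (rot_action (g p)) $ k $ m + e k * rot_action (rot_action (g p)) $ j $ m
       - e m * rot_action (rot_action (g p)) $ j $ k)))"
    unfolding chr partial_derivI[OF has_derivative_mult_right[OF d, of "1/2"]]
    by (simp add: axis_def e_def)
  also have "(1/2) * (\<Sum>m\<in>UNIV. rot_action (I p) $ l $ m *
      (e j * rot_action (g p) $ k $ m + e k * rot_action (g p) $ j $ m - e m * rot_action (g p) $ j $ k)
      + I p $ l $ m *
      (e j * rot_action (rot_action (g p)) $ k $ m + e k * rot_action (rot_action (g p)) $ j $ m
       - e m * rot_action (rot_action (g p)) $ j $ k)) =
    (\<Sum>m\<in>UNIV. rot_gen $ l $ m * christoffel g p m j k + rot_gen $ j $ m * christoffel g p l m k + rot_gen $ k $ m * christoffel g p l j m)"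
  proof -
    define a where "a = rot_action (g p)"
    have ra: "rot_action Y $ j $ k = (\<Sum>m\<in>UNIV. rot_gen $ j $ m * Y $ m $ k + rot_gen $ k $ m * Y $ j $ m)" for Y j k
      by (simp add: rot_action_def matrix_matrix_mult_def transpose_def sum.distrib mult_ac)
    \<comment> \<open>The generator acts on products and contractions as a derivation and
      annihilates the third coordinate covector \<open>e\<close>, so both sides agree. Quantifying
      over the indices lets \<open>forall_3\<close> reduce this to finitely many component
      identities.\<close>
    have "\<forall>l j k. (1/2) * (\<Sum>m\<in>UNIV. rot_action (I p) $ l $ m *
      (e j * a $ k $ m + e k * a $ j $ m - e m * a $ j $ k)
      + I p $ l $ m *
      (e j * rot_action a $ k $ m + e k * rot_action a $ j $ m - e m * rot_action a $ j $ k)) =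
    (\<Sum>m\<in>UNIV. rot_gen $ l $ m * christoffel g p m j k + rot_gen $ j $ m * christoffel g p l m k
       + rot_gen $ k $ m * christoffel g p l j m)"
      unfolding forall_3 sum_3 chr a_def[symmetric] ra[of a] ra[of "I p"] rot_gen_nth
      by (simp add: e_def) (simp add: field_simps)
    then show ?thesis unfolding a_def by blast
  qed
  finally show ?thesis by (simp add: e_def)
qed

text \<open>
  The covariant derivative on left invariant fields, read off at \<open>p\<close>: the field that equals \<open>v\<close> at
  \<open>p\<close> has ordinary derivative \<open>u\<^sub>3 J v\<close> in the direction \<open>u\<close>. Rotations preserve the bracket, so
  \<open>E2_bracket\<close> is also the bracket of left invariant fields in terms of their values at \<open>p\<close>.
\<close>

definition invariant_connection :: "tensor_field \<Rightarrow> real^3 \<Rightarrow> real^3 \<Rightarrow> real^3 \<Rightarrow> real^3" where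
  "invariant_connection g p u v =
     (\<chi> k. \<Sum>i\<in>UNIV. \<Sum>j\<in>UNIV. christoffel g p k i j * u $ i * v $ j) + u $ 3 *\<^sub>R (rot_gen *v v)"

lemma bilinear_invariant_connection: "bilinear (invariant_connection g p)"
  unfolding bilinear_def
  by (auto intro!: linearI simp: invariant_connection_def vec_eq_iff sum.distrib sum_distrib_left
      algebra_simps matrix_vector_right_distrib matrix_vector_mult_scaleR)

lemma bilinear_E2_bracket: "bilinear E2_bracket"
  unfolding bilinear_def
  by (auto intro!: linearI simp: E2_bracket_eq vec_eq_iff forall_3 algebra_simps)

text \<open>\<open>N (e i)\<close> is the matrix of Christoffel symbols, plus \<open>rot_gen\<close>
  when \<open>i = 3\<close>. The commutators yield the quadratic Christoffel terms and the
  commutator with \<open>rot_gen\<close>; the latter is the \<theta>-derivative in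
  \<open>riemann\<close> up to the rotation of one lower index, which the bracket term
  supplies.\<close>

lemma riemann_connection:
  fixes i j k :: 3 and p :: "real^3"
  assumes "riemannian_metric g" "left_invariant g"
  defines "N \<equiv> invariant_connection g p" and "e \<equiv> \<lambda>i. axis i 1 :: real^3"
  shows "riemann g p l i j k =
    (N (e i) (N (e j) (e k)) - N (e j) (N (e i) (e k)) - N (E2_bracket (e i) (e j)) (e k)) $ l"
proof -
  have Ne: "N (e i) v $ l = (\<Sum>j\<in>UNIV. (christoffel g p l i j + (if i = 3 then rot_gen $ l $ j else 0)) * v $ j)" for i l v
  proof -
    have "\<forall>i. N (e i) v $ l = (\<Sum>j\<in>UNIV. (christoffel g p l i j + (if i = 3 then rot_gen $ l $ j else 0)) * v $ j)"
      unfolding forall_3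
      by (simp add: N_def e_def invariant_connection_def matrix_vector_mult_def axis_def sum_3 algebra_simps)
    then show ?thesis by blast
  qed
  have br: "E2_bracket (e 1) (e 1) = 0" "E2_bracket (e 2) (e 2) = 0" "E2_bracket (e 3) (e 3) = 0"
    "E2_bracket (e 1) (e 2) = 0" "E2_bracket (e 2) (e 1) = 0"
    "E2_bracket (e 2) (e 3) = e 1" "E2_bracket (e 3) (e 2) = - e 1"
    "E2_bracket (e 3) (e 1) = e 2" "E2_bracket (e 1) (e 3) = - e 2"
    by (simp_all add: E2_bracket_eq e_def axis_def vec_eq_iff forall_3)
  have lin: "N (- u) v = - N u v" "N 0 v = 0" for u v
    by (simp_all add: N_def bilinear_lneg[OF bilinear_invariant_connection] bilinear_lzero[OF bilinear_invariant_connection])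
  have e: "e i $ j = (if i = j then 1 else 0)" for i j
    by (auto simp add: e_def axis_def)
  have "\<forall>i j k l. riemann g p l i j k =
    (N (e i) (N (e j) (e k)) - N (e j) (N (e i) (e k)) - N (E2_bracket (e i) (e j)) (e k)) $ l"
    unfolding riemann_def partial_deriv_christoffel[OF assms(1,2)] forall_3 br lin
    by (simp add: Ne e sum_3 rot_gen_nth) (simp add: algebra_simps)
  then show ?thesis by blast
qed

text \<open>Both sides are trilinear, so agreement on coordinate vectors suffices.\<close>

lemma curvature_connection:
  fixes p :: "real^3"
  assumes "riemannian_metric g" "left_invariant g"
  defines "N \<equiv> invariant_connection g p"
  shows "curvature g p u v w = N u (N v w) - N v (N u w) - N (E2_bracket u v) w"
proof -
  define T where "T u v w = N u (N v w) - N v (N u w) - N (E2_bracket u v) w" for u v w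
  note N = bilinear_invariant_connection[of g p, folded N_def]
  note B = bilinear_E2_bracket
  note simps = bilinear_ladd[OF N] bilinear_radd[OF N] bilinear_lmul[OF N] bilinear_rmul[OF N]
    bilinear_ladd[OF B] bilinear_radd[OF B] bilinear_lmul[OF B] bilinear_rmul[OF B] T_def algebra_simps
  have l: "linear (\<lambda>u. T u v w)" "linear (\<lambda>v. T u v w)" "linear (\<lambda>w. T u v w)" for u v w
    by (auto intro!: linearI simp: simps)
  have ex: "v = (\<Sum>i\<in>UNIV. v $ i *\<^sub>R axis i 1)" for v :: "real^3"
    by (simp add: vec_eq_iff axis_def if_distrib cong: if_cong)
  have "T u v w = (\<Sum>i\<in>UNIV. \<Sum>j\<in>UNIV. \<Sum>k\<in>UNIV.
      u $ i *\<^sub>R v $ j *\<^sub>R w $ k *\<^sub>R T (axis i 1) (axis j 1) (axis k 1))"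
  proof -
    have t1: "T u v w = (\<Sum>i\<in>UNIV. u $ i *\<^sub>R T (axis i 1) v w)" for u v w
      by (subst ex[of u]) (simp add: linear_sum[OF l(1)] linear_scale[OF l(1)])
    have t2: "T u v w = (\<Sum>i\<in>UNIV. v $ i *\<^sub>R T u (axis i 1) w)" for u v w
      by (subst ex[of v]) (simp add: linear_sum[OF l(2)] linear_scale[OF l(2)])
    have t3: "T u v w = (\<Sum>i\<in>UNIV. w $ i *\<^sub>R T u v (axis i 1))" for u v w
      by (subst ex[of w]) (simp add: linear_sum[OF l(3)] linear_scale[OF l(3)])
    show ?thesis
      unfolding t1[of u v w]
      unfolding t2[of "axis i 1" v w for i]
      unfolding t3[of "axis i 1" "axis j 1" w for i j] scaleR_sum_right ..
  qed
  then have "T u v w = curvature g p u v w"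
    by (simp add: vec_eq_iff curvature_def riemann_connection[OF assms(1,2)] T_def N_def mult_ac)
  then show ?thesis by (simp add: T_def)
qed


section \<open>Torsion and metric compatibility\<close>

text \<open>The Christoffel part is symmetric and cancels; the two \<open>rot_gen\<close> terms that
  remain form the bracket.\<close>

lemma connection_torsion_free:
  assumes "riemannian_metric g" 
  shows "invariant_connection g p u v - invariant_connection g p v u = E2_bracket u v"
proof -
  have s: "(\<lambda>q. g q $ j $ i) = (\<lambda>q. g q $ i $ j)" for i j
    using riemannian_symmetric[OF assms] by blast
  have "christoffel g p k j i = christoffel g p k i j" for i j k
    unfolding christoffel_def s[of j i] by (simp add: algebra_simps)
  then have S: "(\<Sum>i\<in>UNIV. \<Sum>j\<in>UNIV. christoffel g p k i j * u $ i * v $ j) =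
      (\<Sum>i\<in>UNIV. \<Sum>j\<in>UNIV. christoffel g p k i j * v $ i * u $ j)" for k
    by (subst sum.swap) (simp add: mult_ac)
  have "invariant_connection g p u v - invariant_connection g p v u =
      u $ 3 *\<^sub>R (rot_gen *v v) - v $ 3 *\<^sub>R (rot_gen *v u)"
    unfolding invariant_connection_def S[of _] by simp
  then show ?thesis
    by (simp add: vec_eq_iff forall_3 E2_bracket_eq rot_gen_def matrix_vector_mult_def sum_3)
qed

text \<open>Left invariant fields have constant inner products, so covariant differentiation along
  \<open>u\<close> acts on them as a skew operator.\<close>

lemma connection_metric:
  assumes "riemannian_metric g" "left_invariant g"
  shows "form (g p) (invariant_connection g p u v) w = - form (g p) v (invariant_connection g p u w)"
proof -
  define G where "G = g p"
  define a where "a = rot_action G"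
  define e :: "3 \<Rightarrow> real" where "e j = (if j = 3 then 1 else 0)" for j
  have sym: "G $ i $ j = G $ j $ i" for i j
    using riemannian_symmetric[OF assms(1)] by (simp add: G_def)
  have chr: "christoffel g p k i j = (1/2) * (\<Sum>l\<in>UNIV. matrix_inv G $ k $ l *
      (e i * a $ j $ l + e j * a $ i $ l - e l * a $ i $ j))" for k i j
    by (simp add: christoffel_left_invariant[OF assms(2)] G_def a_def e_def)
  have inv: "(\<Sum>k\<in>UNIV. G $ m $ k * matrix_inv G $ k $ l) = (if m = l then 1 else 0)" for m l
    using matrix_mul_inv[OF riemannian_invertible[OF assms(1)], of p]
    by (simp add: vec_eq_iff matrix_matrix_mult_def mat_def G_def)
  \<comment> \<open>Lowering the index removes the inverse metric; what is left is linear in the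
    derivative \<open>a\<close> of the metric.\<close>
  have low: "(\<Sum>k\<in>UNIV. G $ m $ k * christoffel g p k i j) =
      (1/2) * (e i * a $ j $ m + e j * a $ i $ m - e m * a $ i $ j)" for m i j
  proof -
    have "(\<Sum>k\<in>UNIV. G $ m $ k * christoffel g p k i j) =
      (1/2) * (\<Sum>l\<in>UNIV. (\<Sum>k\<in>UNIV. G $ m $ k * matrix_inv G $ k $ l) *
      (e i * a $ j $ l + e j * a $ i $ l - e l * a $ i $ j))"
      unfolding chr sum_3 by (simp add: field_simps)
    then show ?thesis by (simp add: inv if_distrib[of "\<lambda>x. x * _"] cong: if_cong)
  qed
  have GN: "(G *v invariant_connection g p u v) $ m =
     (\<Sum>i\<in>UNIV. \<Sum>j\<in>UNIV. (1/2) * (e i * a $ j $ m + e j * a $ i $ m - e m * a $ i $ j) * u $ i * v $ j)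
     + u $ 3 * (\<Sum>k\<in>UNIV. G $ m $ k * (\<Sum>j\<in>UNIV. rot_gen $ k $ j * v $ j))" for u v m
    unfolding low[symmetric] invariant_connection_def matrix_vector_mult_def sum_3
    by (simp add: algebra_simps)
  have "form G v (invariant_connection g p u w) + form G w (invariant_connection g p u v) = 0"
    unfolding form_inner inner_vec_def GN
    by (simp add: sum_3 e_def a_def rot_action_def rot_gen_def matrix_matrix_mult_def transpose_def
       sym[of 2 1] sym[of 3 1] sym[of 3 2]) (simp add: algebra_simps)
  moreover have "form G (invariant_connection g p u v) w = form G w (invariant_connection g p u v)"
    using assms(1) by (simp add: riemannian_metric_def G_def)
  ultimately show ?thesis by (simp add: G_def)
qed

lemma matrix_conj_linear:
  fixes A B X Y :: "real^'n^'n"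
  shows "A ** (X + Y) ** B = A ** X ** B + A ** Y ** B"
    and "A ** (X - Y) ** B = A ** X ** B - A ** Y ** B"
    and "A ** (c *\<^sub>R X) ** B = c *\<^sub>R (A ** X ** B)"
  by (simp_all add: vec_eq_iff matrix_matrix_mult_def sum_distrib_left sum_distrib_right
      sum.distrib sum_subtractf algebra_simps)

section \<open>Symmetries of the curvature and the Ricci trace\<close>

lemma curvature_antisym:
  "curvature g p u v w = - curvature g p v u w"
proof -
  have R: "riemann g p l i j k * u $ i * v $ j * w $ k =
      - (riemann g p l j i k * v $ j * u $ i * w $ k)" for l i j k
    by (simp add: riemann_def sum_subtractf algebra_simps)
  have "curvature g p u v w $ l =
      (\<Sum>i\<in>UNIV. \<Sum>j\<in>UNIV. \<Sum>k\<in>UNIV. - (riemann g p l j i k * v $ j * u $ i * w $ k))" for l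
    unfolding curvature_def vec_lambda_beta by (intro sum.cong refl R)
  also have "\<dots> l = - curvature g p v u w $ l" for l
    unfolding curvature_def vec_lambda_beta by (subst sum.swap) (simp add: sum_negf)
  finally show ?thesis by (simp add: vec_eq_iff)
qed

text \<open>Commutators of the skew operators \<open>invariant_connection g p u\<close> are skew,
  and so is the bracket term.\<close>

lemma curvature_skew:
  assumes "riemannian_metric g" "left_invariant g"
  shows "form (g p) (curvature g p u v w) z = - form (g p) w (curvature g p u v z)"
  by (simp add: curvature_connection[OF assms] connection_metric[OF assms] form_simps)

lemma ricci_trace:
  assumes "orthonormal_frame (g p) f"
  shows "form (ricci g p) v w = (\<Sum>a\<in>UNIV. form (g p) (f a) (curvature g p (f a) v w))"
proof -
  \<comment> \<open>The matrix of the endomorphism that sends \<open>u\<close> to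
    \<open>curvature g p u v w\<close>, whose trace is the Ricci form.\<close>
  define M :: "real^3^3" where
    "M = (\<chi> l i. \<Sum>j\<in>UNIV. \<Sum>k\<in>UNIV. riemann g p l i j k * v $ j * w $ k)"
  have "M *v u = curvature g p u v w" for u
    by (simp add: vec_eq_iff curvature_def M_def matrix_vector_mult_def sum_distrib_right sum_distrib_left mult_ac)
  moreover have "trace M = form (ricci g p) v w"
    unfolding trace_def form_def ricci_def M_def vec_lambda_beta sum_3
    by (simp add: algebra_simps)
  ultimately show ?thesis using frame_trace[OF assms, of M] by simp
qed

section \<open>The cross curvature tensor in Ricci frames\<close>

definition diagonal_matrix :: "('n \<Rightarrow> real) \<Rightarrow> real^'n^'n" where
  "diagonal_matrix r = (\<chi> a b. if a = b then r a else 0)"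

lemma diagonal_matrix_mult:
  "diagonal_matrix r ** diagonal_matrix s = diagonal_matrix (\<lambda>a. r a * s a)"
  by (simp add: diagonal_matrix_def matrix_matrix_mult_def vec_eq_iff if_distrib[of "\<lambda>x. x * _"] cong: if_cong)

lemma det_diagonal_matrix: "det (diagonal_matrix r) = (\<Prod>a\<in>UNIV. r a)"
  by (subst det_diagonal) (auto simp: diagonal_matrix_def)

text \<open>
  \<open>K\<^sub>m K\<^sub>n\<close> is a quadratic polynomial in the Ricci eigenvalue \<open>r\<^sub>l\<close> whose coefficients are
  frame independent. This gives a tensor that is diagonal, with the prescribed entries, in every
  Ricci frame at once.
\<close>

definition cross_form :: "tensor_field \<Rightarrow> real^3 \<Rightarrow> real^3^3" where
  "cross_form g p = (let I = matrix_inv (g p); R = ricci g p; S = scalar_curvature g p in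
     R ** I ** R - (S / 2) *\<^sub>R R + (S\<^sup>2 / 4 - trace (I ** R ** I ** R) / 2) *\<^sub>R g p)"

context
  fixes g :: tensor_field and p :: "real^3" and f :: "3 \<Rightarrow> real^3"
  assumes metric: "riemannian_metric g" "left_invariant g"
    and frame: "ricci_frame g p f"
begin

private abbreviation "\<Phi> \<equiv> frame_matrix f"
private abbreviation "r \<equiv> \<lambda>a. form (ricci g p) (f a) (f a)"
private abbreviation "S \<equiv> scalar_curvature g p"

lemma ricci_frame_orthonormal: "orthonormal_frame (g p) f"
  using frame by (simp add: ricci_frame_def orthonormal_frame_def)

lemma ricci_frame_diagonal: "transpose \<Phi> ** ricci g p ** \<Phi> = diagonal_matrix r"
  using frame by (simp add: vec_eq_iff form_frame_matrix diagonal_matrix_def ricci_frame_def)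

lemma scalar_curvature_frame: "S = (\<Sum>a\<in>UNIV. r a)"
proof -
  have "S = trace (matrix_inv (g p) ** transpose (ricci g p))"
    by (simp add: scalar_curvature_def trace_def matrix_matrix_mult_def transpose_def)
  also have "\<dots> = trace (\<Phi> ** (transpose \<Phi> ** transpose (ricci g p)))"
    by (simp add: frame_metric_inv[OF ricci_frame_orthonormal] matrix_mul_assoc)
  also have "\<dots> = trace (transpose \<Phi> ** transpose (ricci g p) ** \<Phi>)"
    by (subst trace_mul_sym) simp
  also have "\<dots> = trace (transpose (diagonal_matrix r))"
    by (simp flip: ricci_frame_diagonal add: matrix_transpose_mul matrix_mul_assoc)
  finally show ?thesis by (simp add: trace_def transpose_def diagonal_matrix_def)
qed

text \<open>In dimension three each Ricci eigenvalue is the sum of the two sectional curvatures of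
  frame planes containing that vector, and \<open>S\<close> is twice the sum of all three. This
  linear system is solved for the curvatures.\<close>

lemma sectional_curvature_frame:
  assumes "distinct [a, b, c]"
  shows "sectional_curvature g p (f a) (f b) = S / 2 - r c"
proof -
  define K where "K a b = form (g p) (f a) (curvature g p (f a) (f b) (f b))" for a b
  have sym: "form (g p) u v = form (g p) v u" for u v
    using metric(1) by (simp add: riemannian_metric_def)
  have K0: "K a a = 0" for a
  proof -
    have "curvature g p (f a) (f a) (f a) = 0"
      using curvature_antisym[of g p "f a" "f a" "f a"] by (simp add: eq_neg_iff_add_eq_0 flip: scaleR_2)
    then show ?thesis by (simp add: K_def form_simps)
  qed
  have Ks: "K a b = K b a" for a b
  proof -
    have "K a b = form (g p) (curvature g p (f a) (f b) (f b)) (f a)"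
      by (simp add: K_def sym)
    also have "\<dots> = - form (g p) (f b) (curvature g p (f a) (f b) (f a))"
      by (rule curvature_skew[OF metric])
    also have "\<dots> = K b a"
      by (subst curvature_antisym) (simp add: K_def form_simps)
    finally show ?thesis .
  qed
  have rK: "r b = (\<Sum>a\<in>UNIV. K a b)" for b
    by (simp add: K_def ricci_trace[of g p f, OF ricci_frame_orthonormal])
  have "\<forall>a b c. distinct [a, b, c] \<longrightarrow> K a b = S / 2 - r c"
    unfolding scalar_curvature_frame rK
    by (simp add: forall_3 sum_3 K0 Ks[of 2 1] Ks[of 3 1] Ks[of 3 2] field_simps)
  moreover have "sectional_curvature g p (f a) (f b) = K a b"
    using frame assms by (simp add: sectional_curvature_def K_def sym ricci_frame_def)
  ultimately show ?thesis using assms by simp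
qed

lemma cross_diagonalI:
  assumes "transpose \<Phi> ** A ** \<Phi> = diagonal_matrix h"
    and "\<And>l m n. distinct [l, m, n] \<Longrightarrow> h l = (S / 2 - r m) * (S / 2 - r n)"
  shows "cross_diagonal g p f A"
  unfolding cross_diagonal_def
proof (intro conjI allI impI)
  have A: "form A (f a) (f b) = (if a = b then h a else 0)" for a b
    using arg_cong[OF assms(1), of "\<lambda>X. X $ a $ b"]
    by (simp add: form_frame_matrix diagonal_matrix_def)
  fix a b :: 3 assume "a \<noteq> b" then show "form A (f a) (f b) = 0" by (simp add: A)
next
  have A: "form A (f a) (f a) = h a" for a
    using arg_cong[OF assms(1), of "\<lambda>X. X $ a $ a"]
    by (simp add: form_frame_matrix diagonal_matrix_def)
  fix l m n :: 3 assume d: "distinct [l, m, n]"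
  then have "sectional_curvature g p (f n) (f l) = S / 2 - r m"
    "sectional_curvature g p (f l) (f m) = S / 2 - r n"
    by (auto intro!: sectional_curvature_frame)
  then show "form A (f l) (f l) =
       sectional_curvature g p (f n) (f l) * sectional_curvature g p (f l) (f m)"
    using assms(2)[OF d] by (simp add: A)
qed

lemma cross_diagonal_unique:
  assumes "cross_diagonal g p f A" "cross_diagonal g p f B"
  shows "A = B"
proof (rule form_frame_eqI[OF ricci_frame_orthonormal])
  fix a b :: 3
  \<comment> \<open>A diagonal entry is prescribed only through a triple of distinct indices, so
    each index must be completed to one.\<close>
  have "distinct [1::3, 2, 3]" "distinct [2::3, 1, 3]" "distinct [3::3, 1, 2]" by simp_all
  then have "\<exists>m n. distinct [a, m, n]" using exhaust_3[of a] by blast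
  then obtain m n where "distinct [a, m, n]" by blast
  then have "form A (f a) (f a) = form B (f a) (f a)"
    using assms unfolding cross_diagonal_def by metis
  then show "form A (f a) (f b) = form B (f a) (f b)"
    using assms by (cases "a = b") (auto simp: cross_diagonal_def)
qed

text \<open>In the frame, \<open>cross_form\<close> becomes a polynomial in the Ricci eigenvalues.
  Substituting their sum for \<open>S\<close> turns its \<open>l\<close>-th entry into the product
  of the other two factors \<open>S / 2 - r m\<close> and \<open>S / 2 - r n\<close>.\<close>

lemma cross_diagonal_cross_form: "cross_diagonal g p f (cross_form g p)"
proof (rule cross_diagonalI)
  define h where "h a = (r a)\<^sup>2 - S / 2 * r a + (S\<^sup>2 / 4 - (\<Sum>b\<in>UNIV. (r b)\<^sup>2) / 2)" for a
  let ?I = "matrix_inv (g p)" and ?R = "ricci g p"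
  note I = frame_metric_inv[OF ricci_frame_orthonormal]
  have sq: "transpose \<Phi> ** ?R ** ?I ** ?R ** \<Phi> = diagonal_matrix (\<lambda>a. (r a)\<^sup>2)"
  proof -
    have "transpose \<Phi> ** ?R ** ?I ** ?R ** \<Phi> = (transpose \<Phi> ** ?R ** \<Phi>) ** (transpose \<Phi> ** ?R ** \<Phi>)"
      by (simp add: I matrix_mul_assoc)
    then show ?thesis by (simp add: ricci_frame_diagonal diagonal_matrix_mult power2_eq_square)
  qed
  have "trace (?I ** ?R ** ?I ** ?R) = trace (\<Phi> ** (transpose \<Phi> ** ?R ** ?I ** ?R))"
    by (subst I) (simp add: matrix_mul_assoc)
  also have "\<dots> = trace (transpose \<Phi> ** ?R ** ?I ** ?R ** \<Phi>)"
    by (rule trace_mul_sym)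
  finally have tr: "trace (?I ** ?R ** ?I ** ?R) = (\<Sum>b\<in>UNIV. (r b)\<^sup>2)"
    by (simp add: sq trace_def diagonal_matrix_def)
  have "transpose \<Phi> ** cross_form g p ** \<Phi> =
     transpose \<Phi> ** ?R ** ?I ** ?R ** \<Phi> - (S / 2) *\<^sub>R (transpose \<Phi> ** ?R ** \<Phi>)
     + (S\<^sup>2 / 4 - trace (?I ** ?R ** ?I ** ?R) / 2) *\<^sub>R (transpose \<Phi> ** g p ** \<Phi>)"
    by (simp add: cross_form_def Let_def matrix_conj_linear matrix_mul_assoc)
  also have "\<dots> = diagonal_matrix h"
    unfolding sq tr ricci_frame_diagonal frame_gram[OF ricci_frame_orthonormal]
    by (simp add: vec_eq_iff diagonal_matrix_def h_def mat_def)
  finally show "transpose \<Phi> ** cross_form g p ** \<Phi> = diagonal_matrix h" .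
  have "\<forall>l m n. distinct [l, m, n] \<longrightarrow> h l = (S / 2 - r m) * (S / 2 - r n)"
    unfolding h_def scalar_curvature_frame
    by (simp add: forall_3 sum_3 field_simps power2_eq_square)
  then show "\<And>l m n. distinct [l, m, n] \<Longrightarrow> h l = (S / 2 - r m) * (S / 2 - r n)" by blast
qed

text \<open>In the frame \<open>P\<close> is diagonal with entries \<open>d a\<close>, the negatives
  of the sectional curvatures. The normalized inverse has entries \<open>d m * d n\<close>, where
  the signs cancel; the factor \<open>(det \<Phi>)\<^sup>2\<close> from the change of frame drops
  out of the quotient of determinants.\<close>

lemma cross_diagonal_adjugate:
  assumes "invertible (P_tensor g p)"
  shows "cross_diagonal g p f
     ((det (P_tensor g p) / det (matrix_inv (g p))) *\<^sub>R matrix_inv (P_tensor g p))"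
proof (rule cross_diagonalI)
  let ?P = "P_tensor g p" and ?I = "matrix_inv (g p)" and ?R = "ricci g p"
  define d where "d a = r a - S / 2" for a
  note I = frame_metric_inv[OF ricci_frame_orthonormal]
  have "?P = ?I ** ?R ** transpose ?I - (S / 2) *\<^sub>R ?I"
    unfolding P_tensor_def vec_eq_iff matrix_matrix_mult_def transpose_def
    by (simp add: sum_3 algebra_simps)
  also have "?I ** ?R ** transpose ?I = \<Phi> ** (transpose \<Phi> ** ?R ** \<Phi>) ** transpose \<Phi>"
    by (simp add: I matrix_transpose_mul matrix_mul_assoc)
  also have "\<dots> - (S / 2) *\<^sub>R ?I = \<Phi> ** (diagonal_matrix r - (S / 2) *\<^sub>R mat 1) ** transpose \<Phi>"
    by (simp add: I ricci_frame_diagonal matrix_conj_linear)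
  also have "diagonal_matrix r - (S / 2) *\<^sub>R mat 1 = diagonal_matrix d"
    by (simp add: vec_eq_iff diagonal_matrix_def d_def mat_def)
  finally have P: "?P = \<Phi> ** diagonal_matrix d ** transpose \<Phi>" .
  have detI: "det ?I = (det \<Phi>)\<^sup>2"
    by (simp add: I det_mul power2_eq_square)
  have detP: "det ?P = (det \<Phi>)\<^sup>2 * (\<Prod>a\<in>UNIV. d a)"
    by (simp add: P det_mul det_diagonal_matrix power2_eq_square)
  have d0: "d a \<noteq> 0" for a
    using assms detP by (auto simp: invertible_det_nz)
  define Y where "Y = transpose \<Phi> ** matrix_inv ?P ** \<Phi>"
  have G: "transpose \<Phi> ** g p ** \<Phi> = mat 1" by (rule frame_gram[OF ricci_frame_orthonormal])
  have "diagonal_matrix d ** Y = ((transpose \<Phi> ** g p) ** \<Phi>) ** diagonal_matrix d ** Y"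
    using G by simp
  also have "\<dots> = (transpose \<Phi> ** g p) ** (?P ** matrix_inv ?P) ** \<Phi>"
    by (simp add: P Y_def matrix_mul_assoc)
  also have "\<dots> = mat 1"
    by (simp add: matrix_mul_inv[OF assms] G)
  finally have "diagonal_matrix (\<lambda>a. 1 / d a) ** diagonal_matrix d ** Y = diagonal_matrix (\<lambda>a. 1 / d a)"
    by (simp flip: matrix_mul_assoc)
  moreover have "diagonal_matrix (\<lambda>a. 1 / d a) ** diagonal_matrix d = mat 1"
    using d0 by (simp add: diagonal_matrix_mult) (simp add: diagonal_matrix_def mat_def)
  ultimately have Y: "Y = diagonal_matrix (\<lambda>a. 1 / d a)" by simp
  let ?h = "\<lambda>a. (\<Prod>b\<in>UNIV. d b) / d a"
  have "transpose \<Phi> ** ((det ?P / det ?I) *\<^sub>R matrix_inv ?P) ** \<Phi> = (\<Prod>a\<in>UNIV. d a) *\<^sub>R Y"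
    using det_frame_matrix[OF ricci_frame_orthonormal]
    by (simp add: Y_def matrix_conj_linear detP detI)
  also have "\<dots> = diagonal_matrix ?h"
    by (simp add: Y vec_eq_iff diagonal_matrix_def)
  finally show "transpose \<Phi> ** ((det ?P / det ?I) *\<^sub>R matrix_inv ?P) ** \<Phi> = diagonal_matrix ?h" .
  have "\<forall>l m n. distinct [l, m, n] \<longrightarrow> ?h l = d m * d n"
  proof -
    have "(\<Prod>b\<in>UNIV. d b) = d 1 * d 2 * d 3"
      unfolding UNIV_3 by (simp add: mult.assoc)
    then show ?thesis by (simp add: forall_3 d0)
  qed
  then show "?h l = (S / 2 - r m) * (S / 2 - r n)" if "distinct [l, m, n]" for l m n
    using that by (simp add: d_def algebra_simps)
qed

end

text \<open>In the singular case the definite description denotes \<open>cross_form\<close>: it is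
  diagonal in every Ricci frame, and the one given frame already forces uniqueness.\<close>

lemma cross_curvature_diagonal:
  assumes "riemannian_metric g" "left_invariant g" "ricci_frame g p f"
  shows "cross_diagonal g p f (cross_curvature g p)"
proof (cases "invertible (P_tensor g p)")
  case True
  then show ?thesis by (simp add: cross_curvature_def cross_diagonal_adjugate[OF assms])
next
  case False
  have "(THE A. \<forall>f. ricci_frame g p f \<longrightarrow> cross_diagonal g p f A) = cross_form g p"
    by (rule the_equality)
       (use assms cross_diagonal_cross_form cross_diagonal_unique in blast)+
  with False show ?thesis
    by (simp add: cross_curvature_def cross_diagonal_cross_form[OF assms])
qed

section \<open>Milnor frames and solitons\<close>

text \<open>The equation says that \<open>(x, y)\<close> and its quarter turn
  \<open>(- y, x)\<close> are orthogonal for the symmetric form with entries \<open>a\<close>,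
  \<open>b\<close>, \<open>b\<close>, \<open>d\<close>.\<close>

lemma planar_principal_direction:
  fixes a b d :: real
  obtains x y where "(x, y) \<noteq> (0, 0)" "b * (x\<^sup>2 - y\<^sup>2) + (d - a) * (x * y) = 0"
proof (cases "b = 0")
  case True
  then show ?thesis using that[of 1 0] by simp
next
  case False
  \<comment> \<open>With \<open>y = 1\<close> the condition is a quadratic equation in
    \<open>x\<close>; \<open>s\<close> is the root of its discriminant.\<close>
  define s where "s = sqrt ((d - a)\<^sup>2 + 4 * b\<^sup>2)"
  have s: "s\<^sup>2 = (d - a)\<^sup>2 + 4 * b\<^sup>2" by (simp add: s_def)
  define x where "x = (s - (d - a)) / (2 * b)"
  have x: "2 * b * x = s - (d - a)" using False by (simp add: x_def)
  have "4 * b * (b * (x\<^sup>2 - 1) + (d - a) * x) = (2 * b * x)\<^sup>2 + 2 * (d - a) * (2 * b * x) - 4 * b\<^sup>2"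
    by (simp add: algebra_simps power2_eq_square)
  also have "\<dots> = 0"
    unfolding x using s by (simp add: algebra_simps power2_eq_square)
  finally show ?thesis using that[of x 1] False by simp
qed

text \<open>The bracket with a vector of third coordinate 1 turns the plane of the first two axes by
  a quarter turn. Principal directions of the metric in that plane are exchanged by this turn up to
  sign, and normalizing them produces the constants. The last clause records that
  \<open>a = b\<close> exactly when the metric on the plane is a multiple of the Euclidean
  one.\<close>

lemma milnor_frame:
  assumes "riemannian_metric g"
  obtains f a b where "orthonormal_frame (g p) f"
    "E2_bracket (f 1) (f 2) = 0" "E2_bracket (f 2) (f 3) = a *\<^sub>R f 1" "E2_bracket (f 3) (f 1) = b *\<^sub>R f 2"
    "a * b > 0" "a = b \<longleftrightarrow> g p $ 1 $ 1 = g p $ 2 $ 2 \<and> g p $ 1 $ 2 = 0"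
proof -
  define G where "G = g p"
  have sym: "form G u v = form G v u" for u v
    using assms by (simp add: riemannian_metric_def G_def)
  have pos: "form G u u > 0" if "u \<noteq> 0" for u
    using assms that by (simp add: riemannian_metric_def G_def)
  have G21: "G $ 2 $ 1 = G $ 1 $ 2"
    using riemannian_symmetric[OF assms] by (simp add: G_def)
  obtain x y where xy: "(x, y) \<noteq> (0, 0)"
    and o: "G $ 1 $ 2 * (x\<^sup>2 - y\<^sup>2) + (G $ 2 $ 2 - G $ 1 $ 1) * (x * y) = 0"
    by (rule planar_principal_direction)
  define n1 n2 :: "real^3" where "n1 = vector [x, y, 0]" and "n2 = vector [- y, x, 0]"
  have n0: "n1 \<noteq> 0" "n2 \<noteq> 0"
    using xy by (auto simp: n1_def n2_def vec_eq_iff forall_3)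
  have n12: "form G n1 n2 = 0"
    using o by (simp add: form_def sum_3 n1_def n2_def G21 algebra_simps power2_eq_square)
  define \<alpha> \<beta> where "\<alpha> = sqrt (form G n1 n1)" and "\<beta> = sqrt (form G n2 n2)"
  have ab0: "\<alpha> > 0" "\<beta> > 0" using pos n0 by (simp_all add: \<alpha>_def \<beta>_def)
  have n11: "form G n1 n1 = \<alpha>\<^sup>2" "form G n2 n2 = \<beta>\<^sup>2"
    using pos[OF n0(1)] pos[OF n0(2)] by (simp_all add: \<alpha>_def \<beta>_def)
  \<comment> \<open>Gram-Schmidt against the plane; the correction lies in the plane, so the third
    coordinate stays 1.\<close>
  define m where "m = axis 3 1 - (form G (axis 3 1) n1 / \<alpha>\<^sup>2) *\<^sub>R n1 - (form G (axis 3 1) n2 / \<beta>\<^sup>2) *\<^sub>R n2"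
  have m3: "m $ 3 = 1" by (simp add: m_def n1_def n2_def axis_def)
  then have m0: "m \<noteq> 0" by auto
  have mn: "form G m n1 = 0" "form G m n2 = 0"
    using ab0 n12 sym[of n2 n1] by (simp_all add: m_def form_simps n11)
  define \<gamma> where "\<gamma> = sqrt (form G m m)"
  have c0: "\<gamma> > 0" using pos m0 by (simp add: \<gamma>_def)
  have mm: "form G m m = \<gamma>\<^sup>2" using pos[OF m0] by (simp add: \<gamma>_def)
  define f :: "3 \<Rightarrow> real^3" where
    "f i = (if i = 1 then (1 / \<alpha>) *\<^sub>R n1 else if i = 2 then (1 / \<beta>) *\<^sub>R n2 else (1 / \<gamma>) *\<^sub>R m)" for i
  have f: "f 1 = (1 / \<alpha>) *\<^sub>R n1" "f 2 = (1 / \<beta>) *\<^sub>R n2" "f 3 = (1 / \<gamma>) *\<^sub>R m"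
    by (simp_all add: f_def)
  have "orthonormal_frame G f"
    unfolding orthonormal_frame_def forall_3 f
    using ab0 c0 n11 n12 mn mm sym[of n2 n1] sym[of n1 m] sym[of n2 m]
    by (simp add: form_simps power2_eq_square)
  moreover have "E2_bracket (f 1) (f 2) = 0"
    by (simp add: f E2_bracket_eq vec_eq_iff forall_3 n1_def n2_def)
  moreover have "E2_bracket (f 2) (f 3) = (\<alpha> / (\<beta> * \<gamma>)) *\<^sub>R f 1"
    using ab0 by (simp add: f E2_bracket_eq vec_eq_iff forall_3 m3) (simp add: n1_def n2_def)
  moreover have "E2_bracket (f 3) (f 1) = (\<beta> / (\<alpha> * \<gamma>)) *\<^sub>R f 2"
    using ab0 by (simp add: f E2_bracket_eq vec_eq_iff forall_3 m3) (simp add: n1_def n2_def)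
  moreover have "\<alpha> / (\<beta> * \<gamma>) * (\<beta> / (\<alpha> * \<gamma>)) > 0" using ab0 c0 by simp
  moreover have "\<alpha> / (\<beta> * \<gamma>) = \<beta> / (\<alpha> * \<gamma>) \<longleftrightarrow> G $ 1 $ 1 = G $ 2 $ 2 \<and> G $ 1 $ 2 = 0"
  proof -
    have "\<alpha> / (\<beta> * \<gamma>) = \<beta> / (\<alpha> * \<gamma>) \<longleftrightarrow> form G n1 n1 = form G n2 n2"
      unfolding n11 using ab0 c0 by (simp add: field_simps power2_eq_square)
    also have "\<dots> \<longleftrightarrow> (G $ 1 $ 1 - G $ 2 $ 2) * (x\<^sup>2 - y\<^sup>2) + 4 * G $ 1 $ 2 * (x * y) = 0"
      by (simp add: form_def sum_3 n1_def n2_def G21) (simp add: algebra_simps power2_eq_square)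
    also have "\<dots> \<longleftrightarrow> G $ 1 $ 1 = G $ 2 $ 2 \<and> G $ 1 $ 2 = 0"
    proof
      define D B where "D = G $ 1 $ 1 - G $ 2 $ 2" and "B = G $ 1 $ 2"
      assume "(G $ 1 $ 1 - G $ 2 $ 2) * (x\<^sup>2 - y\<^sup>2) + 4 * G $ 1 $ 2 * (x * y) = 0"
      then have 1: "D * (x\<^sup>2 - y\<^sup>2) + 4 * B * (x * y) = 0" by (simp add: D_def B_def)
      have 2: "B * (x\<^sup>2 - y\<^sup>2) - D * (x * y) = 0" using o by (simp add: D_def B_def algebra_simps)
      \<comment> \<open>Cramer's rule for the two homogeneous linear equations in \<open>D\<close>
        and \<open>B\<close>, whose determinant is
        \<open>(x\<^sup>2 + y\<^sup>2)\<^sup>2\<close>.\<close>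
      have "D * (x\<^sup>2 + y\<^sup>2)\<^sup>2 = (D * (x\<^sup>2 - y\<^sup>2) + 4 * B * (x * y)) * (x\<^sup>2 - y\<^sup>2)
          - 4 * (x * y) * (B * (x\<^sup>2 - y\<^sup>2) - D * (x * y))"
        by (simp add: algebra_simps power2_eq_square)
      moreover have "B * (x\<^sup>2 + y\<^sup>2)\<^sup>2 = (D * (x\<^sup>2 - y\<^sup>2) + 4 * B * (x * y)) * (x * y)
          + (x\<^sup>2 - y\<^sup>2) * (B * (x\<^sup>2 - y\<^sup>2) - D * (x * y))"
        by (simp add: algebra_simps power2_eq_square)
      moreover have "x\<^sup>2 + y\<^sup>2 \<noteq> 0" using xy by (simp add: sum_power2_eq_zero_iff)
      ultimately have "D = 0" "B = 0" using 1 2 by auto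
      then show "G $ 1 $ 1 = G $ 2 $ 2 \<and> G $ 1 $ 2 = 0" by (simp add: D_def B_def)
    qed simp
    finally show ?thesis .
  qed
  ultimately show ?thesis by (intro that) (auto simp: G_def)
qed

text \<open>
  Milnor's computation for a unimodular group with structure constants \<open>(a, b, 0)\<close>.
\<close>

context
  fixes g :: tensor_field and p :: "real^3" and f :: "3 \<Rightarrow> real^3" and a b :: real
  assumes metric: "riemannian_metric g" "left_invariant g"
    and ortho: "orthonormal_frame (g p) f"
    and brackets: "E2_bracket (f 1) (f 2) = 0" "E2_bracket (f 2) (f 3) = a *\<^sub>R f 1"
      "E2_bracket (f 3) (f 1) = b *\<^sub>R f 2"
begin

private abbreviation "N \<equiv> invariant_connection g p"

private lemmas N_simps =
  bilinear_lmul[OF bilinear_invariant_connection] bilinear_rmul[OF bilinear_invariant_connection]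
  bilinear_lneg[OF bilinear_invariant_connection] bilinear_rneg[OF bilinear_invariant_connection]
  bilinear_lzero[OF bilinear_invariant_connection] bilinear_rzero[OF bilinear_invariant_connection]

lemma form_frame: "form (g p) (f i) (f j) = (if i = j then 1 else 0)"
  using ortho by (simp add: orthonormal_frame_def)

text \<open>As in Koszul's formula, skewness in the last two indices leaves nine unknown
  coefficients \<open>c i j k\<close>, which the torsion equations for the three brackets
  determine.\<close>

lemma milnor_connection:
  "N (f 1) (f 1) = 0" "N (f 1) (f 2) = ((b - a) / 2) *\<^sub>R f 3" "N (f 1) (f 3) = ((a - b) / 2) *\<^sub>R f 2"
  "N (f 2) (f 1) = ((b - a) / 2) *\<^sub>R f 3" "N (f 2) (f 2) = 0" "N (f 2) (f 3) = ((a - b) / 2) *\<^sub>R f 1"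
  "N (f 3) (f 1) = ((a + b) / 2) *\<^sub>R f 2" "N (f 3) (f 2) = - ((a + b) / 2) *\<^sub>R f 1" "N (f 3) (f 3) = 0"
proof -
  define c where "c i j k = form (g p) (f k) (N (f i) (f j))" for i j k
  have sym: "form (g p) u v = form (g p) v u" for u v
    using metric(1) by (simp add: riemannian_metric_def)
  have skew: "c i j k = - c i k j" for i j k
    unfolding c_def by (subst sym, subst connection_metric[OF metric]) (simp add: sym)
  have tors: "c i j k - c j i k = form (g p) (f k) (E2_bracket (f i) (f j))" for i j k
    by (simp add: c_def form_simps(4) connection_torsion_free[OF metric(1), of p, symmetric])
  have expand: "N (f i) (f j) = c i j 1 *\<^sub>R f 1 + c i j 2 *\<^sub>R f 2 + c i j 3 *\<^sub>R f 3" for i j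
    using frame_expand[OF ortho, of "N (f i) (f j)"] by (simp add: sum_3 c_def)
  have diag: "c i j j = 0" for i j using skew[of i j j] by simp
  have t12: "c 1 2 k = c 2 1 k" for k using tors[of 1 2 k] by (simp add: brackets form_simps)
  have t23: "c 2 3 k - c 3 2 k = (if k = 1 then a else 0)" for k
    using tors[of 2 3 k] by (simp add: brackets form_simps form_frame)
  have t31: "c 3 1 k - c 1 3 k = (if k = 2 then b else 0)" for k
    using tors[of 3 1 k] by (simp add: brackets form_simps form_frame)
  have c: "c 1 1 2 = 0" "c 1 1 3 = 0" "c 1 2 3 = (b - a) / 2" "c 2 2 3 = 0" "c 2 1 2 = 0" "c 2 1 3 = (b - a) / 2"
     "c 3 1 3 = 0" "c 3 2 3 = 0" "c 3 1 2 = (a + b) / 2"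
    using t12[of 1] t12[of 2] t12[of 3] t23[of 1] t23[of 2] t23[of 3] t31[of 1] t31[of 2] t31[of 3]
      skew[of _ 2 1] skew[of _ 3 1] skew[of _ 3 2] diag
    by (simp_all add: field_simps)
  show "N (f 1) (f 1) = 0" "N (f 1) (f 2) = ((b - a) / 2) *\<^sub>R f 3" "N (f 1) (f 3) = ((a - b) / 2) *\<^sub>R f 2"
  "N (f 2) (f 1) = ((b - a) / 2) *\<^sub>R f 3" "N (f 2) (f 2) = 0" "N (f 2) (f 3) = ((a - b) / 2) *\<^sub>R f 1"
  "N (f 3) (f 1) = ((a + b) / 2) *\<^sub>R f 2" "N (f 3) (f 2) = - ((a + b) / 2) *\<^sub>R f 1" "N (f 3) (f 3) = 0"
    unfolding expand diag skew[of _ 2 1] skew[of _ 3 1] skew[of _ 3 2] c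
    by (simp_all add: minus_divide_left)
qed

lemma milnor_curvature:
  "curvature g p (f 1) (f 2) (f 1) = - ((a - b)\<^sup>2 / 4) *\<^sub>R f 2"
  "curvature g p (f 1) (f 2) (f 2) = ((a - b)\<^sup>2 / 4) *\<^sub>R f 1"
  "curvature g p (f 1) (f 2) (f 3) = 0"
  "curvature g p (f 2) (f 3) (f 1) = 0"
  "curvature g p (f 2) (f 3) (f 2) = ((a - b) * (3 * a + b) / 4) *\<^sub>R f 3"
  "curvature g p (f 2) (f 3) (f 3) = - ((a - b) * (3 * a + b) / 4) *\<^sub>R f 2"
  "curvature g p (f 3) (f 1) (f 1) = ((a - b) * (a + 3 * b) / 4) *\<^sub>R f 3"
  "curvature g p (f 3) (f 1) (f 2) = 0"
  "curvature g p (f 3) (f 1) (f 3) = - ((a - b) * (a + 3 * b) / 4) *\<^sub>R f 1"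
proof -
  show "curvature g p (f 1) (f 2) (f 1) = - ((a - b)\<^sup>2 / 4) *\<^sub>R f 2"
  "curvature g p (f 1) (f 2) (f 2) = ((a - b)\<^sup>2 / 4) *\<^sub>R f 1"
  "curvature g p (f 1) (f 2) (f 3) = 0"
  "curvature g p (f 2) (f 3) (f 1) = 0"
  "curvature g p (f 2) (f 3) (f 2) = ((a - b) * (3 * a + b) / 4) *\<^sub>R f 3"
  "curvature g p (f 2) (f 3) (f 3) = - ((a - b) * (3 * a + b) / 4) *\<^sub>R f 2"
  "curvature g p (f 3) (f 1) (f 1) = ((a - b) * (a + 3 * b) / 4) *\<^sub>R f 3"
  "curvature g p (f 3) (f 1) (f 2) = 0"
  "curvature g p (f 3) (f 1) (f 3) = - ((a - b) * (a + 3 * b) / 4) *\<^sub>R f 1"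
    unfolding curvature_connection[OF metric] brackets milnor_connection N_simps
    by (simp_all add: scaleR_left_distrib[symmetric] scaleR_left_diff_distrib[symmetric]
       scaleR_minus_left[symmetric] del: scaleR_minus_left)
       (simp_all add: vec_eq_iff field_simps power2_eq_square)
qed

lemma milnor_curvature_swap:
  "curvature g p (f i) (f i) w = 0"
  "curvature g p (f 2) (f 1) w = - curvature g p (f 1) (f 2) w"
  "curvature g p (f 3) (f 2) w = - curvature g p (f 2) (f 3) w"
  "curvature g p (f 1) (f 3) w = - curvature g p (f 3) (f 1) w"
proof -
  show "curvature g p (f i) (f i) w = 0"
    using curvature_antisym[of g p "f i" "f i" w] by (simp add: eq_neg_iff_add_eq_0 flip: scaleR_2)
qed (rule curvature_antisym)+

text \<open>The curvature operator of two distinct frame vectors preserves their plane and kills the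
  third vector, so the mixed Ricci terms vanish.\<close>

lemma milnor_ricci_frame: "ricci_frame g p f"
  unfolding ricci_frame_def ricci_trace[of g p f, OF ortho]
  by (simp add: form_frame)
     (simp add: forall_3 sum_3 milnor_curvature milnor_curvature_swap form_simps form_frame)

lemma milnor_cross_curvature:
  "form (cross_curvature g p) (f 1) (f 1) = (a - b) ^ 3 * (a + 3 * b) / 16"
  "form (cross_curvature g p) (f 2) (f 2) = - ((a - b) ^ 3 * (3 * a + b) / 16)"
proof -
  have d: "distinct [1::3, 2, 3]" "distinct [2::3, 1, 3]" by simp_all
  note c = cross_curvature_diagonal[OF metric milnor_ricci_frame, unfolded cross_diagonal_def, THEN conjunct2, rule_format]
  show "form (cross_curvature g p) (f 1) (f 1) = (a - b) ^ 3 * (a + 3 * b) / 16"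
    unfolding c[OF d(1)] sectional_curvature_def
    by (simp add: milnor_curvature milnor_curvature_swap form_simps form_frame power3_eq_cube power2_eq_square)
  show "form (cross_curvature g p) (f 2) (f 2) = - ((a - b) ^ 3 * (3 * a + b) / 16)"
    unfolding c[OF d(2)] sectional_curvature_def
    by (simp add: milnor_curvature milnor_curvature_swap form_simps form_frame power3_eq_cube power2_eq_square)
qed

text \<open>Every curvature component in the frame carries a factor \<open>a - b\<close>;
  multilinearity extends the vanishing to all vectors.\<close>

lemma milnor_flat:
  assumes "a = b"
  shows "curvature g p u v w = 0"
proof -
  note B = bilinear_E2_bracket
  note N = bilinear_invariant_connection
  have lin: "linear (\<lambda>u. curvature g p u v w)" "linear (\<lambda>v. curvature g p u v w)"
      "linear (\<lambda>w. curvature g p u v w)" for u v w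
    unfolding curvature_connection[OF metric]
    by (auto intro!: linearI simp: algebra_simps bilinear_ladd[OF N] bilinear_radd[OF N] bilinear_lmul[OF N]
      bilinear_rmul[OF N] bilinear_ladd[OF B] bilinear_radd[OF B] bilinear_lmul[OF B] bilinear_rmul[OF B])
  have "\<forall>i j k. curvature g p (f i) (f j) (f k) = 0"
    by (simp add: forall_3 milnor_curvature milnor_curvature_swap assms)
  then have "curvature g p (f i) (f j) w = 0" for i j w
    using frame_linear_eqI[OF ortho lin(3)[of "f i" "f j"] linear_zero] by blast
  then have "curvature g p (f i) v w = 0" for i v w
    using frame_linear_eqI[OF ortho lin(2)[of "f i" w] linear_zero] by blast
  then show ?thesis
    using frame_linear_eqI[OF ortho lin(1)[of v w] linear_zero] by blast
qed

end

section \<open>Algebraic solitons\<close>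

text \<open>Positive definiteness makes the representing vector unique, which evaluates the definite
  description.\<close>

lemma hat_operator_eqI:
  assumes "riemannian_metric g" "\<And>v. form (g 0) w v = form (T g 0) u v"
  shows "hat_operator T g u = w"
  unfolding hat_operator_def
proof (rule the_equality)
  show "\<forall>v. form (g 0) w v = form (T g 0) u v" using assms by blast
next
  fix w' assume "\<forall>v. form (g 0) w' v = form (T g 0) u v"
  then have "form (g 0) (w' - w) (w' - w) = 0"
    by (simp add: form_simps(3) assms(2))
  then show "w' = w"
    using assms(1) unfolding riemannian_metric_def by (metis eq_iff_diff_eq_0 less_irrefl)
qed

text \<open>The frame consists of eigenvectors of the derivation. The two bracket relations force
  its third eigenvalue to vanish and the first two to agree; the shift by \<open>\<kappa>\<close>
  cancels in the comparison.\<close>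

lemma soliton_eigenvalues:
  assumes "algebraic_soliton T g \<kappa>" and "orthonormal_frame (g 0) f"
    and diag: "\<And>i j. i \<noteq> j \<Longrightarrow> form (T g 0) (f i) (f j) = 0"
    and brackets: "E2_bracket (f 2) (f 3) = a *\<^sub>R f 1" "E2_bracket (f 3) (f 1) = b *\<^sub>R f 2"
    and nz: "a \<noteq> 0" "b \<noteq> 0"
  shows "form (T g 0) (f 1) (f 1) = form (T g 0) (f 2) (f 2)"
proof -
  define h where "h i = form (T g 0) (f i) (f i)" for i
  define D where "D u = hat_operator T g u - \<kappa> *\<^sub>R u" for u
  have rm: "riemannian_metric g" and D: "linear D"
    and der: "D (E2_bracket u v) = E2_bracket (D u) v + E2_bracket u (D v)" for u v
    using assms(1) unfolding algebraic_soliton_def E2_derivation_def D_def by blast+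
  have lin: "linear (form A u)" for A u
    using bilinear_form by (simp add: bilinear_def)
  have "hat_operator T g (f i) = h i *\<^sub>R f i" for i
  proof (rule hat_operator_eqI[OF rm])
    fix v
    show "form (g 0) (h i *\<^sub>R f i) v = form (T g 0) (f i) v"
    proof (rule frame_linear_eqI[OF assms(2) lin[of "g 0" "h i *\<^sub>R f i"] lin[of "T g 0" "f i"]])
      show "form (g 0) (h i *\<^sub>R f i) (f j) = form (T g 0) (f i) (f j)" for j
        using assms(2) diag[of i j] by (auto simp: form_simps orthonormal_frame_def h_def)
    qed
  qed
  moreover define d where "d i = h i - \<kappa>" for i
  ultimately have Df: "D (f i) = d i *\<^sub>R f i" for i
    by (simp add: D_def scaleR_left_diff_distrib)
  note B = bilinear_E2_bracket
  have f0: "f i \<noteq> 0" for i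
    using assms(2) form_simps(9) unfolding orthonormal_frame_def by (metis zero_neq_one)
  note simps = Df brackets linear_scale[OF D] bilinear_lmul[OF B] bilinear_rmul[OF B]
  have "(a * d 1) *\<^sub>R f 1 = (a * (d 2 + d 3)) *\<^sub>R f 1"
    using der[of "f 2" "f 3"] by (simp add: simps algebra_simps)
  moreover have "(b * d 2) *\<^sub>R f 2 = (b * (d 3 + d 1)) *\<^sub>R f 2"
    using der[of "f 3" "f 1"] by (simp add: simps algebra_simps)
  ultimately have "d 1 = d 2" using nz f0 by simp
  then show ?thesis by (simp add: h_def d_def)
qed

text \<open>A multiple of the Euclidean metric on the plane is unchanged by rotation, so roundness
  at the identity spreads to every point.\<close>

lemma conformal_left_invariant:
  assumes "left_invariant g" "g 0 $ 1 $ 1 = g 0 $ 2 $ 2" "g 0 $ 1 $ 2 = 0" "g 0 $ 2 $ 1 = 0"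
  shows "g p $ 1 $ 1 = g p $ 2 $ 2 \<and> g p $ 1 $ 2 = 0"
  by (subst (1 2 3) left_invariant_rot[OF assms(1)])
     (simp add: E2_rot_def matrix_matrix_mult_def sum_3 transpose_def assms(2-4))

theorem theorem3p5:
  fixes g :: tensor_field and \<epsilon> :: real
  assumes "riemannian_metric g" and "left_invariant g"
    and "\<epsilon> = 1 \<or> \<epsilon> = -1"
  shows "(flat_metric g \<longrightarrow> xcf_fixed_point g \<and> steady_algebraic_soliton (xcf_tensor \<epsilon>) g)
    \<and> ((\<exists>\<kappa>. algebraic_soliton (xcf_tensor \<epsilon>) g \<kappa>) \<longrightarrow> flat_metric g)"
proof (intro conjI impI)
  assume "flat_metric g"
  then have curv: "curvature g p u v w = 0" for p u v w
    by (simp add: flat_metric_def)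
  have zero: "cross_curvature g p = 0" for p
  proof -
    obtain f a b where f: "orthonormal_frame (g p) f" "E2_bracket (f 1) (f 2) = 0"
      "E2_bracket (f 2) (f 3) = a *\<^sub>R f 1" "E2_bracket (f 3) (f 1) = b *\<^sub>R f 2"
      using milnor_frame[OF assms(1)] by metis
    note rf = milnor_ricci_frame[OF assms(1,2) f]
    \<comment> \<open>All sectional curvatures vanish, so the zero tensor meets the diagonal
      description, and uniqueness identifies it with the cross curvature.\<close>
    have "cross_diagonal g p f 0"
      by (simp add: cross_diagonal_def sectional_curvature_def curv form_simps) (simp add: form_def)
    then show ?thesis
      using cross_diagonal_unique[OF assms(1,2) rf] cross_curvature_diagonal[OF assms(1,2) rf] by blast
  qed
  then show "xcf_fixed_point g" by (simp add: xcf_fixed_point_def)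
  have "hat_operator (xcf_tensor \<epsilon>) g u = 0" for u
    by (rule hat_operator_eqI[OF assms(1)]) (simp add: xcf_tensor_def zero form_def)
  then show "steady_algebraic_soliton (xcf_tensor \<epsilon>) g"
    using assms(1,2)
    by (simp add: steady_algebraic_soliton_def algebraic_soliton_def E2_derivation_def linear_zero
        bilinear_lzero[OF bilinear_E2_bracket] bilinear_rzero[OF bilinear_E2_bracket])
next
  assume "\<exists>\<kappa>. algebraic_soliton (xcf_tensor \<epsilon>) g \<kappa>"
  then obtain \<kappa> where sol: "algebraic_soliton (xcf_tensor \<epsilon>) g \<kappa>" by blast
  obtain f a b where f: "orthonormal_frame (g 0) f" "E2_bracket (f 1) (f 2) = 0"
      "E2_bracket (f 2) (f 3) = a *\<^sub>R f 1" "E2_bracket (f 3) (f 1) = b *\<^sub>R f 2"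
    and ab: "a * b > 0" and round: "a = b \<longleftrightarrow> g 0 $ 1 $ 1 = g 0 $ 2 $ 2 \<and> g 0 $ 1 $ 2 = 0"
    using milnor_frame[OF assms(1)] by metis
  note rf = milnor_ricci_frame[OF assms(1,2) f]
  have T: "form (xcf_tensor \<epsilon> g 0) u v = \<epsilon> * form (cross_curvature g 0) u v" for u v
    by (simp add: xcf_tensor_def form_def sum_distrib_left mult_ac)
  have off: "form (xcf_tensor \<epsilon> g 0) (f i) (f j) = 0" if "i \<noteq> j" for i j
    using cross_curvature_diagonal[OF assms(1,2) rf] that by (simp add: T cross_diagonal_def)
  have "form (xcf_tensor \<epsilon> g 0) (f 1) (f 1) = form (xcf_tensor \<epsilon> g 0) (f 2) (f 2)"
    using ab by (intro soliton_eigenvalues[OF sol f(1) off f(3,4)]) auto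
  \<comment> \<open>The sign \<open>\<epsilon>\<close> occurs on both sides and cancels, which
    treats both flows at once.\<close>
  then have "(a - b) ^ 3 * (a + 3 * b) / 16 = - ((a - b) ^ 3 * (3 * a + b) / 16)"
    using assms(3) by (auto simp: T milnor_cross_curvature[OF assms(1,2) f])
  moreover have "(a - b) ^ 3 * (a + 3 * b) + (a - b) ^ 3 * (3 * a + b) = 4 * ((a - b) ^ 3 * (a + b))"
    by (simp add: algebra_simps)
  ultimately have "(a - b) ^ 3 * (a + b) = 0"
    by linarith
  moreover have "a + b \<noteq> 0"
    using ab by (auto simp: add_eq_0_iff zero_less_mult_iff)
  ultimately have "a = b" by simp
  \<comment> \<open>The soliton condition gives \<open>a = b\<close> only at the identity. Expressed
    through metric components it transfers to every \<open>p\<close>, where a new Milnor frame then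
    has equal constants.\<close>
  then have conf: "g p $ 1 $ 1 = g p $ 2 $ 2 \<and> g p $ 1 $ 2 = 0" for p
    using round riemannian_symmetric[OF assms(1), of 0 2 1]
    by (intro conformal_left_invariant[OF assms(2)]) auto
  have "curvature g p u v w = 0" for p u v w
  proof -
    obtain f a b where f: "orthonormal_frame (g p) f" "E2_bracket (f 1) (f 2) = 0"
      "E2_bracket (f 2) (f 3) = a *\<^sub>R f 1" "E2_bracket (f 3) (f 1) = b *\<^sub>R f 2"
      and "a = b"
      using milnor_frame[OF assms(1), of p] conf[of p] by metis
    then show ?thesis by (intro milnor_flat[OF assms(1,2) f])
  qed
  then show "flat_metric g" by (simp add: flat_metric_def)
qed

end
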